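(* Let $q=p^e>4$, where $p$ is a prime, and let $\ell$ be a positive integer with $2\ell\mid e$. The following statements hold. (1) For every $3\le k\le\frac{q-1}{p^\ell+1}$ and every $0\le h\le k-2$, there exists a $[[q+2,k-h,q-k+2;q+2-k-h]]_q$ AMDS EAQECC. (2) Let $k=1+\frac{q-1}{p^\ell+1}$. For every $0\le h\le k-2$, there exists a $[[q+2,k-h,q-k+2;q+2-k-h]]_q$ AMDS EAQECC. (3) Let $k=1+\frac{q-1}{p^\ell+1}$. Then there exists a $[[q+2,1,q-k+2;q+3-2k]]_q$ AMDS EAQECC. (4) If $\frac{q-1}{p^\ell+1}\ge p^\ell$ and $k=2+\frac{q-1}{p^\ell+1}$, then there exists a $[[q+2,1,q-k+2;q+3-2k]]_q$ AMDS EAQECC.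
   Context: A $q$-ary entanglement-assisted quantum error-correcting code (EAQECC) with parameters $[[n,K,d_Q;c]]_q$ encodes $K$ logical qudits (each with state space $\mathbb C^q$) into $n$ physical qudits with the assistance of $c$ maximally entangled pairs shared in advance between sender and receiver, and has minimum distance $d_Q$. Here the receiver's halves of the pairs are error-free, and the minimum distance is the largest integer $d_Q$ such that every error $E$ acting nontrivially on at most $d_Q-1$ of the $n$ physical (transmitted) qudits is detected, i.e. $P(E\otimes I)P=c_EP$ for some scalar $c_E$, where $P$ is the projector onto the code space and $I$ acts on the receiver's halves. Terminology: if $2d_Q\le n+2$, the entanglement-assisted Singleton bound gives $n+c-K\ge 2(d_Q-1)$. In this range, equality gives an MDS EAQECC, while $n+c-K=2d_Q$ gives an AMDS (almost MDS) EAQECC. For $2d_Q>n+2$, the same inequality is not a general bound on all EAQECCs. *)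

theory Defs
  imports Jordan_Normal_Form.Schur_Decomposition "HOL-Computational_Algebra.Primes"
begin

text \<open>
  A register of \<open>m\<close> qudits of local dimension \<open>q\<close> is \<open>\<complex>^(q^m)\<close>, realised by
  \<open>carrier_vec (q ^ m)\<close>: the standard basis vector number \<open>x < q ^ m\<close> is the product state whose
  \<open>j\<close>-th qudit is in the state given by the \<open>j\<close>-th base-\<open>q\<close> digit of \<open>x\<close>.  In a tensor product the
  index of the first factor is the more significant one, so juxtaposing registers agrees with the
  tensor products below and these are associative on the nose.
\<close>

definition tensor_vec :: "complex vec \<Rightarrow> complex vec \<Rightarrow> complex vec" where
  "tensor_vec v w =
     vec (dim_vec v * dim_vec w) (\<lambda>i. v $ (i div dim_vec w) * w $ (i mod dim_vec w))"

definition tensor_mat :: "complex mat \<Rightarrow> complex mat \<Rightarrow> complex mat" where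
  "tensor_mat A B =
     mat (dim_row A * dim_row B) (dim_col A * dim_col B)
       (\<lambda>(i, j). A $$ (i div dim_row B, j div dim_col B) * B $$ (i mod dim_row B, j mod dim_col B))"

definition qudit :: "nat \<Rightarrow> nat \<Rightarrow> nat \<Rightarrow> nat" where
  "qudit q j x = x div q ^ j mod q"

text \<open>
  The joint state \<open>q^(-c/2) * (\<Sum>a < q^c. |a>|a>)\<close> of \<open>c\<close> maximally entangled pairs; the first
  register holds the sender's halves, the second one the receiver's halves.
\<close>

definition ebits :: "nat \<Rightarrow> nat \<Rightarrow> complex vec" where
  "ebits q c =
     vec (q ^ c * q ^ c)
       (\<lambda>i. if i div q ^ c = i mod q ^ c then complex_of_real (1 / sqrt (real (q ^ c))) else 0)"

text \<open>
  The sender encodes the \<open>K\<close> logical qudits together with her \<open>c\<close> halves into \<open>n\<close> physical qudits by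
  an isometry (a unitary on \<open>n\<close> qudits, the remaining \<open>n - K - c\<close> inputs being fixed ancillas).  The
  code space lies in the space of the \<open>n\<close> transmitted qudits and the receiver's \<open>c\<close> halves.
\<close>

definition encoding_isometry :: "nat \<Rightarrow> nat \<Rightarrow> nat \<Rightarrow> nat \<Rightarrow> complex mat \<Rightarrow> bool" where
  "encoding_isometry q n K c V \<longleftrightarrow>
     V \<in> carrier_mat (q ^ n) (q ^ (K + c)) \<and> mat_adjoint V * V = 1\<^sub>m (q ^ (K + c))"

definition code_space :: "nat \<Rightarrow> nat \<Rightarrow> nat \<Rightarrow> complex mat \<Rightarrow> complex vec set" where
  "code_space q K c V =
     {tensor_mat V (1\<^sub>m (q ^ c)) *\<^sub>v tensor_vec \<psi> (ebits q c) | \<psi>. \<psi> \<in> carrier_vec (q ^ K)}"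

definition projector_onto :: "nat \<Rightarrow> complex mat \<Rightarrow> complex vec set \<Rightarrow> bool" where
  "projector_onto N P W \<longleftrightarrow>
     P \<in> carrier_mat N N \<and> mat_adjoint P = P \<and> P * P = P \<and> {P *\<^sub>v v | v. v \<in> carrier_vec N} = W"

text \<open>
  \<open>E\<close> acts trivially outside the set \<open>S\<close> of qudits, i.e. it is an arbitrary operator on the qudits in
  \<open>S\<close> tensored with the identity on the others.
\<close>

definition acts_within :: "nat \<Rightarrow> nat \<Rightarrow> nat set \<Rightarrow> complex mat \<Rightarrow> bool" where
  "acts_within q n S E \<longleftrightarrow>
     E \<in> carrier_mat (q ^ n) (q ^ n) \<and>
     (\<exists>F :: (nat \<Rightarrow> nat) \<Rightarrow> (nat \<Rightarrow> nat) \<Rightarrow> complex. \<forall>x < q ^ n. \<forall>y < q ^ n.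
        E $$ (x, y) =
          (if \<forall>j \<in> {..<n} - S. qudit q j x = qudit q j y
           then F (\<lambda>j. if j \<in> S then qudit q j x else 0) (\<lambda>j. if j \<in> S then qudit q j y else 0)
           else 0))"

definition detects :: "nat \<Rightarrow> nat \<Rightarrow> complex mat \<Rightarrow> complex mat \<Rightarrow> bool" where
  "detects q c P E \<longleftrightarrow>
     (\<exists>a :: complex. P * tensor_mat E (1\<^sub>m (q ^ c)) * P = a \<cdot>\<^sub>m P)"

definition detects_all_below :: "nat \<Rightarrow> nat \<Rightarrow> nat \<Rightarrow> complex mat \<Rightarrow> nat \<Rightarrow> bool" where
  "detects_all_below q n c P d \<longleftrightarrow>
     (\<forall>S E. S \<subseteq> {..<n} \<and> card S < d \<and> acts_within q n S E \<longrightarrow> detects q c P E)"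

definition min_distance :: "nat \<Rightarrow> nat \<Rightarrow> nat \<Rightarrow> complex mat \<Rightarrow> nat \<Rightarrow> bool" where
  "min_distance q n c P d \<longleftrightarrow>
     detects_all_below q n c P d \<and> (\<forall>d'. detects_all_below q n c P d' \<longrightarrow> d' \<le> d)"

text \<open>\<open>W\<close> is the code space of an EAQECC with parameters \<open>[[n, K, d; c]]_q\<close>.\<close>

definition EAQECC :: "nat \<Rightarrow> nat \<Rightarrow> nat \<Rightarrow> nat \<Rightarrow> nat \<Rightarrow> complex vec set \<Rightarrow> bool" where
  "EAQECC q n K d c W \<longleftrightarrow>
     (\<exists>V. encoding_isometry q n K c V \<and> W = code_space q K c V) \<and>
     (\<exists>P. projector_onto (q ^ n * q ^ c) P W \<and> min_distance q n c P d)"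

text \<open>
  Almost MDS means that the parameters satisfy \<open>n + c - K = 2 * d\<close>.  The condition \<open>2 * d \<le> n + 2\<close>,
  under which this says "one short of the entanglement-assisted Singleton bound", is deliberately
  not imposed: the codes of length \<open>q + 2\<close> called AMDS here lie outside that range.
\<close>

definition AMDS_EAQECC :: "nat \<Rightarrow> nat \<Rightarrow> nat \<Rightarrow> nat \<Rightarrow> nat \<Rightarrow> complex vec set \<Rightarrow> bool" where
  "AMDS_EAQECC q n K d c W \<longleftrightarrow>
     EAQECC q n K d c W \<and> int n + int c - int K = 2 * int d"

text \<open>The quotient \<open>(q - 1) / (p^l + 1)\<close> is an integer, so \<open>div\<close> computes it exactly.\<close>

lemma succ_power_dvd:
  fixes p l e :: nat
  assumes "2 * l dvd e"
  shows "p ^ l + 1 dvd p ^ e - 1"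
proof (cases "p = 0")
  case False
  obtain m where e: "e = 2 * l * m" using assms by (elim dvdE)
  define a where "a = int p ^ l"
  have "a + 1 dvd a ^ 2 - 1"
    by (simp add: power2_eq_square square_diff_one_factored)
  also have "a ^ 2 - 1 dvd (a ^ 2) ^ m - 1"
    using power_diff_1_eq[of "a ^ 2" m] by simp
  also have "(a ^ 2) ^ m = int p ^ e"
    by (simp add: a_def e power_mult [symmetric] mult_ac)
  finally have "int (p ^ l + 1) dvd int (p ^ e - 1)"
    using False by (simp add: a_def of_nat_diff add.commute)
  then show ?thesis by (simp only: int_dvd_int_iff)
next
  case True
  then show ?thesis by (simp add: power_0_left)
qed

end

theory Submission
  imports Defs
begin

text \<open>
  The code is of CSS type.  Let \<open>D\<^sub>m\<close> be the space of polynomials of degree less than \<open>m\<close>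
  over the field with \<open>q\<close> elements, and let \<open>w\<close> be a polynomial of degree \<open>r = q - k - h\<close> without
  roots in the field and with leading coefficient different from \<open>1\<close>.  Evaluation at all field
  elements, together with the coefficient of \<open>X^(k-1)\<close> in \<open>f\<close> and of \<open>X^(q-k)\<close> in \<open>g\<close> as value
  at infinity, turns the spaces of all \<open>w f\<close> with \<open>f\<close> in \<open>D\<^sub>k\<close> and of all \<open>g\<close> in \<open>D\<^bsub>q-k+1\<^esub>\<close> into
  MDS codes of length \<open>q + 1\<close>.  As \<open>w f\<close> has degree less than \<open>q\<close>, their intersection can be read off
  the polynomials: it is \<open>w D\<^sub>h\<close>.  The \<open>X\<close>-type errors with trivial syndrome form the first code and
  the \<open>Z\<close>-type ones the dual of the second code, so all errors of weight at most \<open>q - k + 1\<close> are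
  detected.  One further ebit whose half is transmitted unencoded brings the length to \<open>q + 2\<close> and
  turns the entanglement-assisted MDS code into an almost MDS code.  In all parts of the theorem
  \<open>h < k\<close> and \<open>2 k < q\<close> (where \<open>h = k - 1\<close> in the last two), hence \<open>r \<ge> 2\<close>, and a suitable \<open>w\<close>
  exists because \<open>X^(r-1) (X - 1)\<close> is not injective, hence not surjective, on the field.

  As types cannot depend on \<open>q\<close>, the field is a quotient of \<open>\<int>[X]\<close> by a prime ideal that
  contains \<open>p\<close> and the polynomials vanishing at a primitive complex \<open>(q - 1)\<close>-st root of unity.
\<close>

section \<open>A field with a prime power number of elements\<close>

text \<open>Equality in the quotient is written as \<open>x - y \<in> M\<close> throughout, so no
  quotient type is formed and polynomials keep their coefficients in the given ring.\<close>

locale prime_ideal =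
  fixes M :: "'a :: comm_ring_1 set"
  assumes zero_mem [simp]: "0 \<in> M"
    and add_mem: "x \<in> M \<Longrightarrow> y \<in> M \<Longrightarrow> x + y \<in> M"
    and mult_mem: "x \<in> M \<Longrightarrow> y * x \<in> M"
    and one_not_mem: "1 \<notin> M"
    and prime_mem: "x * y \<in> M \<Longrightarrow> x \<in> M \<or> y \<in> M"
begin

lemma mult_mem': "x \<in> M \<Longrightarrow> x * y \<in> M"
  by (subst mult.commute) (rule mult_mem)

lemma minus_mem: "x \<in> M \<Longrightarrow> - x \<in> M"
  using mult_mem[of x "-1"] by simp

lemma diff_mem: "x \<in> M \<Longrightarrow> y \<in> M \<Longrightarrow> x - y \<in> M"
  using add_mem[of x "- y"] minus_mem[of y] by simp

lemma sum_mem: "(\<And>i. i \<in> I \<Longrightarrow> f i \<in> M) \<Longrightarrow> sum f I \<in> M"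
  by (induction I rule: infinite_finite_induct) (auto intro: add_mem)

lemma add_mem_cancel: "y \<in> M \<Longrightarrow> x + y \<in> M \<longleftrightarrow> x \<in> M"
  using diff_mem[of "x + y" y] add_mem[of x y] by auto

lemma power_diff_mem: "x - y \<in> M \<Longrightarrow> x ^ n - y ^ n \<in> M"
  by (subst power_diff_sumr2) (rule mult_mem')

lemma power_mem: "x ^ n \<in> M \<Longrightarrow> x \<in> M"
  by (induction n) (use one_not_mem prime_mem in auto)

lemma poly_mem: "(\<And>i. coeff f i \<in> M) \<Longrightarrow> poly f x \<in> M"
  by (simp add: poly_altdef sum_mem mult_mem')

text \<open>The quotient by \<open>M\<close> is an integral domain, where a nonzero polynomial has
  no more roots than its degree. Dividing by \<open>X - x\<close> lowers the degree, and the other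
  points of \<open>S\<close> remain roots because \<open>y - x\<close> is not in
  \<open>M\<close>.\<close>

lemma coeffs_mem_if_many_roots_aux:
  assumes "finite S" "degree f < card S" "\<And>x. x \<in> S \<Longrightarrow> poly f x \<in> M"
    and "\<And>x y. x \<in> S \<Longrightarrow> y \<in> S \<Longrightarrow> x - y \<in> M \<Longrightarrow> x = y"
  shows "coeff f i \<in> M"
  using assms
proof (induction S arbitrary: f i rule: finite_induct)
  case (insert x S)
  define g where "g = synthetic_div f x"
  have f: "f = [:- x, 1:] * g + [:poly f x:]"
    unfolding g_def by (rule synthetic_div_correct'[symmetric])
  have fx: "poly f x \<in> M" using insert.prems(2)[of x] by simp
  have g: "coeff g j \<in> M" for j
  proof (cases "degree f = 0")
    case True
    then have "g = 0" by (simp add: g_def synthetic_div_eq_0_iff)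
    then show ?thesis by simp
  next
    case False
    show ?thesis
    proof (rule insert.IH)
      show "degree g < card S"
        using False insert.prems(1) insert.hyps by (simp add: g_def degree_synthetic_div)
    next
      fix y assume y: "y \<in> S"
      have "poly f y = (y - x) * poly g y + poly f x"
        by (subst f) (simp add: algebra_simps)
      then have "(y - x) * poly g y \<in> M"
        using insert.prems(2)[of y] y fx add_mem_cancel by auto
      moreover have "y - x \<notin> M"
        using insert.prems(3)[of y x] y insert.hyps by auto
      ultimately show "poly g y \<in> M" using prime_mem by blast
    next
      fix y z assume "y \<in> S" "z \<in> S" "y - z \<in> M"
      then show "y = z" using insert.prems(3) by simp
    qed
  qed
  have "coeff f i = - x * coeff g i + (case i of 0 \<Rightarrow> 0 | Suc j \<Rightarrow> coeff g j)
          + (if i = 0 then poly f x else 0)"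
    by (subst f) (auto simp: coeff_pCons split: nat.splits)
  also have "\<dots> \<in> M"
    by (intro add_mem) (auto intro: mult_mem g fx minus_mem split: nat.splits)
  finally show ?case .
qed simp

text \<open>Here only the degree modulo \<open>M\<close> is below \<open>D\<close>. Truncating at
  \<open>D\<close> changes all values by elements of \<open>M\<close> and makes the true degree
  small.\<close>

lemma coeffs_mem_if_many_roots:
  assumes "finite S" "D \<le> card S" "\<And>x. x \<in> S \<Longrightarrow> poly f x \<in> M"
    and "\<And>x y. x \<in> S \<Longrightarrow> y \<in> S \<Longrightarrow> x - y \<in> M \<Longrightarrow> x = y"
    and high: "\<And>i. i \<ge> D \<Longrightarrow> coeff f i \<in> M"
  shows "coeff f i \<in> M"
proof (cases "i < D")
  case True
  have *: "poly (poly_cutoff D f) x \<in> M" if "x \<in> S" for x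
  proof -
    have "poly (f - poly_cutoff D f) x \<in> M"
      by (rule poly_mem) (auto simp: coeff_poly_cutoff high)
    from diff_mem[OF assms(3)[OF that] this] show ?thesis by simp
  qed
  have "degree (poly_cutoff D f) \<le> D - 1"
    by (rule degree_le) (use True in \<open>auto simp: coeff_poly_cutoff\<close>)
  then have "degree (poly_cutoff D f) < card S" using True assms(2) by linarith
  from coeffs_mem_if_many_roots_aux[OF assms(1) this * assms(4), of i]
  show ?thesis using True by (simp add: coeff_poly_cutoff)
qed (use high in simp)

text \<open>Leading coefficients multiply, even if \<open>u\<close> has degree at most
  \<open>s\<close> only modulo \<open>M\<close>.\<close>

lemma coeff_mult_top:
  assumes "degree w \<le> r" "\<And>j. j > s \<Longrightarrow> coeff u j \<in> M"
  shows "coeff (w * u) (r + s) - coeff w r * coeff u s \<in> M"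
proof -
  have "coeff (w * u) (r + s) = (\<Sum>i\<le>r + s. coeff w i * coeff u (r + s - i))"
    by (rule coeff_mult)
  also have "\<dots> = coeff w r * coeff u s + (\<Sum>i\<in>{..r + s} - {r}. coeff w i * coeff u (r + s - i))"
    by (subst sum.remove[of _ r]) auto
  finally have "coeff (w * u) (r + s) - coeff w r * coeff u s =
    (\<Sum>i\<in>{..r + s} - {r}. coeff w i * coeff u (r + s - i))" by simp
  also have "\<dots> \<in> M"
  proof (rule sum_mem)
    fix i assume i: "i \<in> {..r + s} - {r}"
    show "coeff w i * coeff u (r + s - i) \<in> M"
    proof (cases "i < r")
      case True
      then show ?thesis by (intro mult_mem assms(2)) auto
    next
      case False
      then have "coeff w i = 0" using i assms(1) by (intro coeff_eq_0) auto
      then show ?thesis by simp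
    qed
  qed
  finally show ?thesis .
qed

text \<open>Degrees add in a domain: the largest \<open>t \<ge> s\<close> with
  \<open>coeff u t\<close> outside \<open>M\<close> would put the coefficient of
  \<open>w * u\<close> in degree \<open>r + t\<close> outside \<open>M\<close>.\<close>

lemma coeffs_mem_if_mult_mem:
  assumes "degree w \<le> r" "coeff w r \<notin> M" "\<And>j. j \<ge> r + s \<Longrightarrow> coeff (w * u) j \<in> M" "i \<ge> s"
  shows "coeff u i \<in> M"
proof (rule ccontr)
  assume i: "coeff u i \<notin> M"
  define A where "A = {i. i \<ge> s \<and> coeff u i \<notin> M}"
  have "A \<subseteq> {..degree u}"
    unfolding A_def using zero_mem by (auto intro: ccontr simp: coeff_eq_0 not_le)
  then have fin: "finite A" by (rule finite_subset) simp
  have "i \<in> A" using i assms(4) by (simp add: A_def)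
  define t where "t = Max A"
  have t: "t \<in> A" unfolding t_def using fin \<open>i \<in> A\<close> by (intro Max_in) auto
  have big: "coeff u j \<in> M" if "j > t" for j
  proof (rule ccontr)
    assume "coeff u j \<notin> M"
    then have "j \<in> A" using that t by (auto simp: A_def)
    then have "j \<le> t" using fin unfolding t_def by (rule Max_ge[rotated])
    then show False using that by simp
  qed
  have "coeff (w * u) (r + t) \<in> M" using t by (intro assms(3)) (simp add: A_def)
  from diff_mem[OF this coeff_mult_top[of w r t u, OF assms(1) big]]
  have "coeff w r * coeff u t \<in> M" by simp
  then show False using prime_mem assms(2) t by (auto simp: A_def)
qed

text \<open>The prime \<open>p\<close> divides all inner binomial coefficients.\<close>

lemma add_power_prime_mem:
  assumes "prime p" "of_nat p \<in> M"
  shows "(x + y) ^ p - (x ^ p + y ^ p) \<in> M"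
proof -
  have p: "p > 0" using assms(1) prime_gt_0_nat by blast
  have "(x + y) ^ p = (\<Sum>k\<le>p. of_nat (p choose k) * x ^ k * y ^ (p - k))"
    by (rule binomial_ring)
  also have "{..p} = insert 0 (insert p {0<..<p})" using p by auto
  finally have "(x + y) ^ p - (x ^ p + y ^ p) =
      (\<Sum>k\<in>{0<..<p}. of_nat (p choose k) * x ^ k * y ^ (p - k))"
    using p by simp
  also have "\<dots> \<in> M"
  proof (rule sum_mem)
    fix k assume "k \<in> {0<..<p}"
    then obtain c where c: "p choose k = p * c"
      using dvd_choose_prime[of k p] assms(1) by (auto elim!: dvdE)
    show "of_nat (p choose k) * x ^ k * y ^ (p - k) \<in> M"
      unfolding c of_nat_mult by (intro mult_mem' assms(2))
  qed
  finally show ?thesis .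
qed

lemma add_power_prime_power_mem:
  assumes "prime p" "of_nat p \<in> M"
  shows "(x + y) ^ (p ^ e) - (x ^ (p ^ e) + y ^ (p ^ e)) \<in> M"
proof (induction e)
  case (Suc e)
  let ?X = "x ^ (p ^ e)" and ?Y = "y ^ (p ^ e)"
  have "((x + y) ^ (p ^ e)) ^ p - (?X + ?Y) ^ p \<in> M"
    using Suc.IH by (rule power_diff_mem)
  moreover have "a - c \<in> M" if "a - b \<in> M" "b - c \<in> M" for a b c
    using add_mem[OF that] by simp
  ultimately have "((x + y) ^ (p ^ e)) ^ p - (?X ^ p + ?Y ^ p) \<in> M"
    using add_power_prime_mem[OF assms, of ?X ?Y] by blast
  then show ?case by (simp only: power_mult [symmetric] power_Suc2)
qed simp

end

text \<open>The field is the quotient of a ring by \<open>M\<close>; its elements are numbered by \<open>sym\<close>.\<close>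

locale finite_residue_field = prime_ideal M for M :: "'a :: comm_ring_1 set" +
  fixes q :: nat and sym :: "'a \<Rightarrow> nat" and rep :: "nat \<Rightarrow> 'a"
  assumes sym_less: "sym x < q"
    and sym_rep: "i < q \<Longrightarrow> sym (rep i) = i"
    and sym_eq_iff: "sym x = sym y \<longleftrightarrow> x - y \<in> M"

section \<open>Prime ideals by Zorn's lemma\<close>

definition is_proper_ideal :: "'a :: comm_ring_1 set \<Rightarrow> bool" where
  "is_proper_ideal I \<longleftrightarrow>
     0 \<in> I \<and> (\<forall>x\<in>I. \<forall>y\<in>I. x + y \<in> I) \<and> (\<forall>x\<in>I. \<forall>y. y * x \<in> I) \<and> 1 \<notin> I"

text \<open>An ideal that is maximal among the proper ideals containing \<open>I\<close> is prime,
  since everything outside it is invertible modulo it.\<close>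

lemma proper_ideal_extends_to_prime_ideal:
  fixes I :: "'a :: comm_ring_1 set"
  assumes "is_proper_ideal I"
  obtains M where "prime_ideal M" "I \<subseteq> M"
proof -
  define A where "A = {J. is_proper_ideal J \<and> I \<subseteq> J}"
  have "\<exists>M\<in>A. \<forall>X\<in>A. M \<subseteq> X \<longrightarrow> X = M"
  proof (rule subset_Zorn_nonempty)
    show "A \<noteq> {}" using assms by (auto simp: A_def)
  next
    fix C assume C: "C \<noteq> {}" "subset.chain A C"
    have CA: "C \<subseteq> A" using C(2) by (simp add: subset.chain_def)
    have "x + y \<in> \<Union>C" if "x \<in> \<Union>C" "y \<in> \<Union>C" for x y
    proof -
      from that obtain X Y where XY: "X \<in> C" "Y \<in> C" "x \<in> X" "y \<in> Y" by blast
      then have "X \<subseteq> Y \<or> Y \<subseteq> X"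
        using C(2) unfolding subset.chain_def by blast
      then obtain Z where "Z \<in> C" "x \<in> Z" "y \<in> Z" using XY by blast
      then have "x + y \<in> Z" using CA by (auto simp: A_def is_proper_ideal_def)
      then show ?thesis using \<open>Z \<in> C\<close> by blast
    qed
    moreover have "y * x \<in> \<Union>C" if "x \<in> \<Union>C" for x y
    proof -
      from that obtain Z where "Z \<in> C" "x \<in> Z" by blast
      then have "y * x \<in> Z" using CA by (auto simp: A_def is_proper_ideal_def)
      then show ?thesis using \<open>Z \<in> C\<close> by blast
    qed
    moreover obtain Z where "Z \<in> C" using C(1) by blast
    then have "I \<subseteq> Z" "Z \<subseteq> \<Union>C" "0 \<in> Z"
      using CA by (auto simp: A_def is_proper_ideal_def)
    moreover have "1 \<notin> \<Union>C"
      using CA by (auto simp: A_def is_proper_ideal_def)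
    ultimately show "\<Union>C \<in> A"
      unfolding A_def is_proper_ideal_def by blast
  qed
  then obtain M where M: "M \<in> A" and max: "\<And>X. X \<in> A \<Longrightarrow> M \<subseteq> X \<Longrightarrow> X = M" by blast
  have Mid: "is_proper_ideal M" and IM: "I \<subseteq> M" using M by (auto simp: A_def)
  have M0: "0 \<in> M" and Ma: "\<And>x y. x \<in> M \<Longrightarrow> y \<in> M \<Longrightarrow> x + y \<in> M"
    and Mm: "\<And>x y. x \<in> M \<Longrightarrow> y * x \<in> M" and M1: "1 \<notin> M"
    using Mid by (auto simp: is_proper_ideal_def)
  \<comment> \<open>Otherwise the ideal \<open>J\<close> generated by \<open>M\<close> and
    \<open>x\<close> would be proper and strictly larger.\<close>
  have inv: "\<exists>m\<in>M. \<exists>z. 1 = m + z * x" if x: "x \<notin> M" for x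
  proof (rule ccontr)
    assume no: "\<not> ?thesis"
    define J where "J = {m + z * x |m z. m \<in> M}"
    have J: "m + z * x \<in> J" if "m \<in> M" for m z unfolding J_def using that by blast
    have "M \<subseteq> J" using J[of _ 0] by auto
    have "is_proper_ideal J" unfolding is_proper_ideal_def
    proof (intro conjI ballI allI)
      show "0 \<in> J" using M0 \<open>M \<subseteq> J\<close> by blast
    next
      fix a b assume "a \<in> J" "b \<in> J"
      then obtain m z m' z' where *: "m \<in> M" "m' \<in> M" "a = m + z * x" "b = m' + z' * x"
        unfolding J_def by blast
      then have "a + b = (m + m') + (z + z') * x" by (simp add: algebra_simps)
      then show "a + b \<in> J" using J[OF Ma[OF *(1,2)]] by simp
    next
      fix a b assume "a \<in> J"
      then obtain m z where *: "m \<in> M" "a = m + z * x" unfolding J_def by blast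
      then have "b * a = b * m + (b * z) * x" by (simp add: algebra_simps)
      then show "b * a \<in> J" using J[OF Mm[OF *(1)]] by simp
    next
      show "1 \<notin> J" using no unfolding J_def by blast
    qed
    then have "J = M" using max[of J] \<open>M \<subseteq> J\<close> IM by (auto simp: A_def)
    moreover have "x \<in> J" using J[OF M0, of 1] by simp
    ultimately show False using x by simp
  qed
  have "prime_ideal M"
  proof
    fix x y assume xy: "x * y \<in> M"
    show "x \<in> M \<or> y \<in> M"
    proof (rule disjCI)
      assume "y \<notin> M"
      then obtain m z where mz: "m \<in> M" "1 = m + z * y" using inv by blast
      have "x = x * (m + z * y)" using mz(2) by simp
      also have "\<dots> = x * m + z * (x * y)" by (simp add: algebra_simps)
      also have "\<dots> \<in> M" using Ma Mm mz(1) xy by simp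
      finally show "x \<in> M" .
    qed
  qed (use M0 Ma Mm M1 in auto)
  then show ?thesis using that IM by blast
qed

text \<open>The number \<open>poly g z\<close> is an eigenvalue of an integral circulant matrix.\<close>

lemma algebraic_int_poly_root_of_unity:
  fixes g :: "int poly" and z :: complex
  assumes "N > 0" "z ^ N = 1"
  shows "algebraic_int (poly (of_int_poly g) z)"
proof -
  \<comment> \<open>Row \<open>i\<close> holds the coefficients of \<open>X^i g\<close> reduced
    modulo \<open>X^N - 1\<close>. The powers of \<open>z\<close> form an eigenvector.\<close>
  define B :: "int mat" where
    "B = mat N N (\<lambda>(i, j). \<Sum>n | n \<le> degree g \<and> (i + n) mod N = j. coeff g n)"
  define v where "v = vec N (\<lambda>i. z ^ i)"
  have zmod: "z ^ (n mod N) = z ^ n" for n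
  proof -
    have "z ^ n = z ^ (N * (n div N) + n mod N)" by simp
    also have "\<dots> = z ^ (n mod N)" unfolding power_add power_mult assms(2) by simp
    finally show ?thesis by simp
  qed
  have B: "B \<in> carrier_mat N N" by (simp add: B_def)
  have "map_mat of_int B *\<^sub>v v = poly (of_int_poly g) z \<cdot>\<^sub>v v"
  proof (rule eq_vecI)
    fix i assume "i < dim_vec (poly (of_int_poly g) z \<cdot>\<^sub>v v)"
    then have i: "i < N" by (simp add: v_def)
    have "(map_mat of_int B *\<^sub>v v) $ i =
        (\<Sum>j<N. (\<Sum>n | n \<le> degree g \<and> (i + n) mod N = j. of_int (coeff g n)) * z ^ j)"
      using i by (simp add: B_def v_def scalar_prod_def atLeast0LessThan)
    also have "\<dots> = (\<Sum>j<N. \<Sum>n | n \<in> {..degree g} \<and> (i + n) mod N = j. of_int (coeff g n) * z ^ (i + n))"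
      unfolding sum_distrib_right
      by (intro sum.cong) (auto simp: zmod)
    also have "\<dots> = (\<Sum>n\<le>degree g. of_int (coeff g n) * z ^ (i + n))"
      using assms(1) by (intro sum.group) auto
    also have "\<dots> = poly (of_int_poly g) z * z ^ i"
      by (simp add: poly_altdef sum_distrib_left sum_distrib_right power_add mult_ac)
    finally show "(map_mat of_int B *\<^sub>v v) $ i = (poly (of_int_poly g) z \<cdot>\<^sub>v v) $ i"
      using i by (simp add: v_def)
  qed (simp_all add: v_def B_def)
  moreover have "v \<noteq> 0\<^sub>v N"
  proof
    assume "v = 0\<^sub>v N"
    then have "v $ 0 = 0" using assms(1) by simp
    then show False using assms(1) by (simp add: v_def)
  qed
  ultimately have "eigenvector (map_mat of_int B) v (poly (of_int_poly g) z)"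
    using B by (auto simp: eigenvector_def v_def)
  then have "eigenvalue (map_mat of_int B) (poly (of_int_poly g) z)"
    by (auto simp: eigenvalue_def)
  then have "poly (char_poly (map_mat of_int B)) (poly (of_int_poly g) z) = 0"
    by (subst (asm) eigenvalue_root_char_poly[of _ N]) (use B in auto)
  then have "poly (of_int_poly (char_poly B)) (poly (of_int_poly g) z) = 0"
    by (simp only: of_int_hom.char_poly_hom[OF B])
  moreover have "lead_coeff (char_poly B) = 1"
    using degree_monic_char_poly[OF B] by simp
  ultimately show ?thesis
    unfolding algebraic_int_altdef_ipoly by blast
qed

text \<open>Modulo \<open>M\<close>, zero and the powers of \<open>X\<close> with exponent below
  \<open>q - 1\<close> are distinct, and every residue is a root of \<open>X^q - X\<close>. This
  polynomial has at most \<open>q\<close> roots, so these \<open>q\<close> elements represent all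
  residues.\<close>

lemma finite_residue_field_exists:
  fixes p e q :: nat
  assumes p: "prime p" and q: "q = p ^ e" and "q > 1"
  obtains M :: "int poly set" and sym rep where "finite_residue_field M q sym rep"
proof -
  define N where "N = q - 1"
  define z where "z = cis (2 * pi / real N)"
  define ev where "ev f = poly (of_int_poly f) z" for f :: "int poly"
  \<comment> \<open>The preimage under \<open>ev\<close> of the multiples of \<open>p\<close>; it
    contains \<open>p\<close> and the kernel of \<open>ev\<close>.\<close>
  define I where "I = {f. \<exists>g. ev f = of_nat p * ev g}"
  have N: "N > 0" "q = Suc N" using \<open>q > 1\<close> by (simp_all add: N_def)
  have zpow: "z ^ i = cis (2 * pi * real i / real N)" for i
    by (simp add: z_def DeMoivre mult_ac)
  have zN: "z ^ N = 1" using N by (simp add: zpow)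
  have z1: "z ^ i \<noteq> 1" if "0 < i" "i < N" for i
  proof
    assume "z ^ i = 1"
    then have "cis (2 * pi * real i / real N) = cis (2 * pi * real 0 / real N)"
      by (simp add: zpow)
    moreover have "inj_on (\<lambda>k. cis (2 * pi * real k / real N)) {..<N}"
      using bij_betw_roots_unity[OF N(1)] by (rule bij_betw_imp_inj_on)
    ultimately have "i = 0" using that by (elim inj_onD) auto
    then show False using that by simp
  qed
  have ev_simps: "ev (f + g) = ev f + ev g" "ev (f - g) = ev f - ev g" "ev (f * g) = ev f * ev g"
    "ev (f ^ n) = ev f ^ n" "ev 0 = 0" "ev 1 = 1" "ev (of_nat n) = of_nat n" for f g n
    by (simp_all add: ev_def hom_distribs)
  have ev_sum: "ev (sum f A) = (\<Sum>i\<in>A. ev (f i))" for f and A :: "nat set"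
    by (induction A rule: infinite_finite_induct) (simp_all add: ev_simps)
  have evX: "ev [:0, 1:] = z" by (simp add: ev_def)
  have "is_proper_ideal I" unfolding is_proper_ideal_def
  proof (intro conjI ballI allI)
    show "0 \<in> I" by (auto simp: I_def ev_simps intro: exI[of _ 0])
  next
    fix x y assume "x \<in> I" "y \<in> I"
    then obtain g h where "ev x = of_nat p * ev g" "ev y = of_nat p * ev h"
      by (auto simp: I_def)
    then have "ev (x + y) = of_nat p * ev (g + h)" by (simp add: ev_simps algebra_simps)
    then show "x + y \<in> I" by (auto simp: I_def)
  next
    fix x y assume "x \<in> I"
    then obtain g where "ev x = of_nat p * ev g" by (auto simp: I_def)
    then have "ev (y * x) = of_nat p * ev (y * g)" by (simp add: ev_simps algebra_simps)
    then show "y * x \<in> I" by (auto simp: I_def)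
  next
    \<comment> \<open>Otherwise \<open>1 / p\<close> would be the value of an integer polynomial at
      a root of unity, hence a rational algebraic integer and so an integer.\<close>
    show "1 \<notin> I"
    proof
      assume "1 \<in> I"
      then obtain g where g: "1 = of_nat p * ev g" by (auto simp: I_def ev_simps)
      have p2: "p \<ge> 2" using p by (rule prime_ge_2_nat)
      have evg: "ev g = 1 / of_nat p" using g p2 by (simp add: field_simps)
      have "ev g \<in> \<int>"
      proof (rule rational_algebraic_int_is_int)
        show "algebraic_int (ev g)"
          unfolding ev_def using N(1) zN by (rule algebraic_int_poly_root_of_unity)
        show "ev g \<in> \<rat>" by (simp add: evg)
      qed
      then obtain k where "ev g = of_int k" by (elim Ints_cases)
      then have "(of_int (int p * k) :: complex) = of_int 1" using g by simp
      then have "int p * k = 1" by (simp only: of_int_eq_iff)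
      then show False using p2 by (auto simp: zmult_eq_1_iff)
    qed
  qed
  then obtain M where M: "prime_ideal M" and IM: "I \<subseteq> M"
    using proper_ideal_extends_to_prime_ideal by blast
  interpret prime_ideal M by (rule M)
  have ker: "f \<in> M" if "ev f = 0" for f
    using IM that by (auto simp: I_def ev_simps intro!: exI[of _ 0])
  have "ev (of_nat p) = of_nat p * ev 1" by (simp add: ev_simps)
  then have pM: "of_nat p \<in> M" using IM by (auto simp only: I_def)
  have "e > 0" using \<open>q > 1\<close> q by (cases e) auto
  then obtain e' where "e = Suc e'" by (cases e) auto
  then have qM: "of_nat q \<in> M" using mult_mem'[OF pM] q by simp
  let ?X = "[:0, 1:] :: int poly"
  have XN: "?X ^ N - 1 \<in> M" by (rule ker) (simp only: ev_simps evX zN diff_self)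
  have trans: "a - c \<in> M" if "a - b \<in> M" "b - c \<in> M" for a b c
    using add_mem[OF that] by simp
  \<comment> \<open>The geometric sum of the powers of \<open>z^i\<close> vanishes. If
    \<open>X^i\<close> were 1 modulo \<open>M\<close>, the same sum would be \<open>N\<close> modulo
    \<open>M\<close>; as \<open>q\<close> is in \<open>M\<close>, so would be
    \<open>1 = q - N\<close>.\<close>
  have X1: "?X ^ i - 1 \<notin> M" if i: "0 < i" "i < N" for i
  proof
    assume *: "?X ^ i - 1 \<in> M"
    have "(z ^ i - 1) * (\<Sum>j<N. (z ^ i) ^ j) = (z ^ i) ^ N - 1"
      by (rule power_diff_1_eq[symmetric])
    also have "\<dots> = 0" by (metis zN power_mult mult.commute power_one diff_self)
    finally have "(\<Sum>j<N. (z ^ i) ^ j) = 0" using z1[OF i] by simp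
    then have "(\<Sum>j<N. (?X ^ i) ^ j) \<in> M" by (intro ker) (simp only: ev_simps ev_sum evX)
    moreover have "(\<Sum>j<N. (?X ^ i) ^ j - 1 ^ j) \<in> M"
      by (intro sum_mem power_diff_mem *)
    ultimately have "of_nat N \<in> M"
      using diff_mem by (fastforce simp: sum_subtractf)
    then have "of_nat q - of_nat N \<in> M" using qM diff_mem by blast
    then show False using one_not_mem N by simp
  qed
  have XM: "?X ^ i \<notin> M" for i
  proof
    assume "?X ^ i \<in> M"
    then have "?X \<in> M" by (rule power_mem)
    then have "?X * ?X ^ (N - 1) \<in> M" by (rule mult_mem')
    then have "?X ^ N \<in> M" using N by (metis power_eq_if less_numeral_extra(3))
    from diff_mem[OF this XN] show False using one_not_mem by simp
  qed
  have Xinj: "i = j" if "?X ^ i - ?X ^ j \<in> M" "i < N" "j < N" for i j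
    using that
  proof (induction i j rule: linorder_wlog)
    case (le i j)
    have "?X ^ i * (?X ^ (j - i) - 1) = - (?X ^ i - ?X ^ j)"
      using le(1) by (simp add: right_diff_distrib flip: power_add)
    then have "?X ^ i * (?X ^ (j - i) - 1) \<in> M"
      using minus_mem[OF le(2)] by (simp only:)
    then have "?X ^ (j - i) - 1 \<in> M" using prime_mem XM by blast
    then show ?case using X1[of "j - i"] le by (cases "i = j") auto
  next
    case (sym i j)
    then show ?case using minus_mem[OF sym(2)] by simp
  qed
  have frob: "(x + y) ^ q - (x ^ q + y ^ q) \<in> M" for x y
    unfolding q by (rule add_power_prime_power_mem[OF p pM])
  have frob_add: "(x + y) ^ q - (x + y) \<in> M" if "x ^ q - x \<in> M" "y ^ q - y \<in> M" for x y
    using add_mem[OF frob[of x y] add_mem[OF that]] by (simp add: algebra_simps)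
  have frob_mult: "(x * y) ^ q - x * y \<in> M" if "x ^ q - x \<in> M" "y ^ q - y \<in> M" for x y
    using add_mem[OF mult_mem[OF that(1), of "y ^ q"] mult_mem[OF that(2), of x]]
    by (simp add: algebra_simps power_mult_distrib)
  have frob_nat: "of_nat n ^ q - of_nat n \<in> M" for n
  proof (induction n)
    case (Suc n)
    from frob_add[OF _ Suc, of 1] show ?case by simp
  qed (use N in simp)
  \<comment> \<open>Constants are congruent to natural numbers modulo \<open>p\<close>, and
    \<open>X^q\<close> is congruent to \<open>X\<close>. The \<open>q\<close>-th power respects sums
    and products modulo \<open>M\<close>.\<close>
  have frob_id: "f ^ q - f \<in> M" for f
  proof (induction f rule: pCons_induct)
    case (pCons a f)
    define n where "n = nat (a mod int p)"
    have "int n + int p * (a div int p) = a"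
      using p prime_gt_0_nat[of p] by (simp add: n_def)
    moreover have "of_nat n + of_nat p * [:a div int p:] = [:int n + int p * (a div int p):]"
      by (simp add: of_nat_poly)
    ultimately have "[:a:] - of_nat n = of_nat p * [:a div int p:]"
      by (simp add: algebra_simps)
    then have an: "[:a:] - of_nat n \<in> M" using mult_mem'[OF pM] by (simp only:)
    have "of_nat n - [:a:] \<in> M" using minus_mem[OF an] by (simp only: minus_diff_eq)
    then have a: "[:a:] ^ q - [:a:] \<in> M"
      using power_diff_mem[OF an, of q] frob_nat[of n] trans by blast
    have X: "?X ^ q - ?X \<in> M" using mult_mem[OF XN, of ?X] N(2) by (simp add: right_diff_distrib)
    have "[:a:] + ?X * f = pCons a f" by simp
    then show ?case using frob_add[OF a frob_mult[OF X pCons.IH]] by simp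
  qed (use N in simp)
  define S where "S = insert 0 ((\<lambda>i. ?X ^ i) ` {..<N})"
  have S_inc: "x = y" if "x \<in> S" "y \<in> S" "x - y \<in> M" for x y
    using that Xinj XM minus_mem[of "x - y"] unfolding S_def by auto
  have "inj_on (\<lambda>i. ?X ^ i) {..<N}" by (rule inj_onI) (use Xinj in auto)
  moreover have "0 \<notin> (\<lambda>i. ?X ^ i) ` {..<N}" by auto
  ultimately have cardS: "card S = q" and finS: "finite S"
    by (simp_all add: S_def card_image N(2))
  \<comment> \<open>A residue missed by \<open>S\<close> would give \<open>X^q - X\<close> more than
    \<open>q\<close> roots and force its leading coefficient 1 into \<open>M\<close>.\<close>
  have cover: "\<exists>s\<in>S. x - s \<in> M" for x
  proof (rule ccontr)
    assume no: "\<not> ?thesis"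
    then have xS: "x \<notin> S" using zero_mem by force
    define f :: "int poly poly" where "f = monom 1 q - monom 1 1"
    have "degree f \<le> q" unfolding f_def using \<open>q > 1\<close>
      by (intro degree_diff_le) (auto simp: degree_monom_eq)
    then have deg: "degree f < card (insert x S)" using finS xS cardS by simp
    have "coeff f q \<in> M"
    proof (rule coeffs_mem_if_many_roots_aux[OF _ deg])
      show "poly f y \<in> M" for y using frob_id[of y] by (simp add: f_def poly_monom)
      show "u = v" if "u \<in> insert x S" "v \<in> insert x S" "u - v \<in> M" for u v
        using that S_inc no minus_mem[of "u - v"] by auto
    qed (use finS in simp)
    then show False using one_not_mem \<open>q > 1\<close> by (simp add: f_def)
  qed
  obtain rep where rep: "bij_betw rep {..<q} S"
    using ex_bij_betw_nat_finite[OF finS] cardS by (auto simp: atLeast0LessThan)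
  have "\<exists>i<q. x - rep i \<in> M" for x
    using cover[of x] rep unfolding bij_betw_def by auto
  then obtain sym where sym: "\<And>x. sym x < q" "\<And>x. x - rep (sym x) \<in> M" by metis
  have rep_inj: "i = j" if "rep i - rep j \<in> M" "i < q" "j < q" for i j
    using S_inc[of "rep i" "rep j"] that rep unfolding bij_betw_def inj_on_def by auto
  have "finite_residue_field M q sym rep"
  proof
    show "sym x < q" for x by (rule sym)
    show "sym (rep i) = i" if "i < q" for i
      using rep_inj[OF _ that sym(1)[of "rep i"]] sym(2)[of "rep i"] by simp
    show "sym x = sym y \<longleftrightarrow> x - y \<in> M" for x y
    proof
      assume "sym x = sym y"
      then show "x - y \<in> M" using diff_mem[OF sym(2)[of x] sym(2)[of y]] by simp
    next
      assume "x - y \<in> M"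
      from diff_mem[OF add_mem[OF this sym(2)[of y]] sym(2)[of x]]
      have "rep (sym x) - rep (sym y) \<in> M" by simp
      then show "sym x = sym y" using rep_inj sym(1) by blast
    qed
  qed
  then show ?thesis by (rule that)
qed

section \<open>Two extended Reed-Solomon codes with prescribed intersection\<close>

lemma qudit_less: "q > 0 \<Longrightarrow> qudit q j x < q"
  by (simp add: qudit_def)

lemma qudit_Suc: "qudit q (Suc j) x = qudit q j (x div q)"
  by (simp add: qudit_def div_mult2_eq mult.commute)

lemma qudit_eqI:
  assumes "x < q ^ n" "y < q ^ n" "\<And>j. j < n \<Longrightarrow> qudit q j x = qudit q j y"
  shows "x = y"
  using assms
proof (induction n arbitrary: x y)
  case (Suc n)
  have "x div q = y div q"
  proof (rule Suc.IH)
    show "x div q < q ^ n" "y div q < q ^ n"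
      using Suc.prems by (simp_all add: less_mult_imp_div_less mult.commute)
    show "qudit q j (x div q) = qudit q j (y div q)" if "j < n" for j
      using Suc.prems(3)[of "Suc j"] that by (simp add: qudit_Suc)
  qed
  moreover have "x mod q = y mod q"
    using Suc.prems(3)[of 0] by (simp add: qudit_def)
  ultimately show ?case by (metis div_mult_mod_eq)
qed simp

fun undigits :: "nat \<Rightarrow> nat \<Rightarrow> (nat \<Rightarrow> nat) \<Rightarrow> nat" where
  "undigits q 0 g = 0"
| "undigits q (Suc n) g = g 0 + q * undigits q n (\<lambda>j. g (Suc j))"

lemma undigits_less: "(\<And>j. j < n \<Longrightarrow> g j < q) \<Longrightarrow> undigits q n g < q ^ n"
proof (induction n arbitrary: g)
  case (Suc n)
  have "undigits q n (\<lambda>j. g (Suc j)) < q ^ n" using Suc.prems by (intro Suc.IH) simp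
  then have "q * (undigits q n (\<lambda>j. g (Suc j)) + 1) \<le> q * q ^ n" by (intro mult_le_mono2) simp
  then show ?case using Suc.prems[of 0] by simp
qed simp

lemma qudit_undigits:
  "(\<And>j. j < n \<Longrightarrow> g j < q) \<Longrightarrow> j < n \<Longrightarrow> qudit q j (undigits q n g) = g j"
proof (induction n arbitrary: g j)
  case (Suc n)
  have g0: "g 0 < q" using Suc.prems by simp
  show ?case
  proof (cases j)
    case 0
    then show ?thesis using g0 by (simp add: qudit_def)
  next
    case (Suc i)
    have "undigits q (Suc n) g div q = undigits q n (\<lambda>j. g (Suc j))"
      using g0 by (simp add: div_mult_self3)
    then show ?thesis
      using Suc Suc.IH[of "\<lambda>j. g (Suc j)" i] Suc.prems by (simp add: qudit_Suc)
  qed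
qed simp

section \<open>Polynomials over the residue field\<close>

context finite_residue_field
begin

lemma q_pos: "q > 0"
  using sym_less[of 0] by simp

lemma rep_diff_mem: "i < q \<Longrightarrow> j < q \<Longrightarrow> rep i - rep j \<in> M \<Longrightarrow> i = j"
  by (metis sym_eq_iff sym_rep)

lemma rep_sym: "rep (sym x) - x \<in> M"
  by (simp add: sym_eq_iff[symmetric] sym_rep sym_less)

lemma coeffs_mem_if_roots_rep:
  assumes "Z \<subseteq> {..<q}" "D \<le> card Z" "\<And>j. j \<in> Z \<Longrightarrow> poly f (rep j) \<in> M"
    and "\<And>i. i \<ge> D \<Longrightarrow> coeff f i \<in> M"
  shows "coeff f i \<in> M"
proof (rule coeffs_mem_if_many_roots)
  have inj: "inj_on rep Z"
    by (rule inj_onI) (use assms(1) rep_diff_mem in \<open>auto simp: subset_iff\<close>)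
  show "finite (rep ` Z)" using assms(1) finite_subset by blast
  show "D \<le> card (rep ` Z)" using assms(2) inj by (simp add: card_image)
  show "x = y" if "x \<in> rep ` Z" "y \<in> rep ` Z" "x - y \<in> M" for x y
    using that rep_diff_mem assms(1) by (auto simp: subset_iff)
qed (use assms in auto)

text \<open>The witness is \<open>u X^(r-1) (X - 1)\<close> minus a value that this polynomial never
  takes. As \<open>r \<ge> 2\<close>, both 0 and 1 are roots, which excludes injectivity and hence
  surjectivity.\<close>

lemma exists_poly_without_roots:
  assumes "r \<ge> 2"
  obtains w where "degree w \<le> r" "coeff w r = u" "\<And>j. j < q \<Longrightarrow> poly w (rep j) \<notin> M"
proof -
  define f where "f = smult u (monom 1 r - monom 1 (r - 1))"
  define \<phi> where "\<phi> j = sym (poly f (rep j))" for j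
  have pf: "poly f x = u * x ^ (r - 1) * (x - 1)" for x
    using assms unfolding f_def
    by (cases r) (simp_all add: poly_monom algebra_simps)
  have "poly f (rep (sym 0)) \<in> M"
  proof -
    have "rep (sym 0) \<in> M" using rep_sym[of 0] by simp
    then have "rep (sym 0) ^ (r - 1) \<in> M"
      using assms by (cases "r - 1") (auto intro: mult_mem')
    then show ?thesis unfolding pf by (intro mult_mem' mult_mem)
  qed
  moreover have "poly f (rep (sym 1)) \<in> M"
    unfolding pf by (intro mult_mem rep_sym)
  ultimately have "\<phi> (sym 0) = \<phi> (sym 1)"
    unfolding \<phi>_def sym_eq_iff by (rule diff_mem)
  moreover have "sym 0 \<noteq> sym 1"
    using one_not_mem minus_mem[of "- 1"] by (auto simp: sym_eq_iff)
  ultimately have "\<not> inj_on \<phi> {..<q}" using sym_less by (auto simp: inj_on_def)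
  then have "\<phi> ` {..<q} \<noteq> {..<q}"
    using eq_card_imp_inj_on[of "{..<q}" \<phi>] by auto
  moreover have "\<phi> ` {..<q} \<subseteq> {..<q}" using sym_less by (auto simp: \<phi>_def)
  ultimately obtain c where c: "c < q" "c \<notin> \<phi> ` {..<q}" by blast
  define w where "w = f - [:rep c:]"
  have "poly w (rep j) \<notin> M" if "j < q" for j
  proof
    assume "poly w (rep j) \<in> M"
    then have "\<phi> j = sym (rep c)" by (simp add: w_def \<phi>_def sym_eq_iff)
    then show False using c that sym_rep by auto
  qed
  moreover have "degree w \<le> r" unfolding w_def f_def
    by (intro degree_diff_le order.trans[OF degree_smult_le]) (auto simp: degree_monom_le
      intro: order.trans[OF degree_monom_le])
  moreover have "coeff w r = u"
    using assms unfolding w_def f_def by (cases r) (auto simp: coeff_pCons split: nat.splits)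
  ultimately show ?thesis using that by blast
qed

end

section \<open>The words of the code and their combinatorial properties\<close>

text \<open>The dimension of the intersection of the two codes is \<open>h\<close>, \<open>K\<close>
  counts the logical qudits, and \<open>r + 2\<close> will be the number of ebits. The condition
  \<open>u - 1 \<notin> M\<close> enters \<open>injective\<close> in the case
  \<open>K = 1\<close>.\<close>

locale twisted_codes = finite_residue_field M q sym rep
  for M :: "'a :: comm_ring_1 set" and q sym rep +
  fixes k h K r :: nat and u :: 'a and w :: "'a poly"
  assumes k: "k = h + K" and K: "K > 0" and q: "q = r + h + k" and r: "r \<ge> 2"
    and degree_w: "degree w \<le> r" and coeff_w: "coeff w r = u"
    and u: "u \<notin> M" "u - 1 \<notin> M"
    and w_rep: "j < q \<Longrightarrow> poly w (rep j) \<notin> M"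
begin

definition digit_poly :: "nat \<Rightarrow> nat \<Rightarrow> nat \<Rightarrow> 'a poly" where
  "digit_poly s N x = (\<Sum>i<N. monom (rep (qudit q i x)) (s + i))"

text \<open>After multiplication by \<open>w\<close>, the part given by \<open>t\<close> runs
  through the intersection \<open>w D_h\<close>, over which the encoded states are superposed;
  \<open>m\<close> selects a coset of it in \<open>w D_k\<close>.\<close>

definition message_poly :: "nat \<Rightarrow> nat \<Rightarrow> 'a poly" where
  "message_poly m t = digit_poly 0 h t + digit_poly h K m"

text \<open>A complement of \<open>w D_h\<close> in the second code: the degrees below
  \<open>r\<close> and the top degree \<open>r + h = q - k\<close>, while \<open>w D_h\<close>
  accounts for the degrees from \<open>r\<close> to \<open>r + h - 1\<close>.\<close>

definition ebit_poly :: "nat \<Rightarrow> 'a poly" where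
  "ebit_poly a = digit_poly 0 r a + monom (rep (qudit q r a)) (r + h)"

text \<open>
  Position \<open>q\<close> is the point at infinity of the extended Reed-Solomon codes; the qudit in
  position \<open>q + 1\<close> is one half of an ebit, sent without encoding.
\<close>

definition symbol :: "nat \<Rightarrow> nat \<Rightarrow> nat \<Rightarrow> nat \<Rightarrow> nat" where
  "symbol m t a j =
     (if j < q then sym (poly (w * message_poly m t + ebit_poly a) (rep j))
      else if j = q then sym (coeff (message_poly m t) (k - 1) + rep (qudit q r a))
      else qudit q (Suc r) a)"

lemma coeff_digit_poly:
  "coeff (digit_poly s N x) i = (if s \<le> i \<and> i < s + N then rep (qudit q (i - s) x) else 0)"
proof -
  have "coeff (digit_poly s N x) i = (\<Sum>j<N. if i - s = j \<and> s \<le> i then rep (qudit q j x) else 0)"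
    unfolding digit_poly_def coeff_sum by (intro sum.cong) auto
  also have "\<dots> = (if s \<le> i \<and> i < s + N then rep (qudit q (i - s) x) else 0)"
    by (cases "s \<le> i") auto
  finally show ?thesis .
qed

lemma coeff_message_poly:
  "coeff (message_poly m t) i =
     (if i < h then rep (qudit q i t) else if i < k then rep (qudit q (i - h) m) else 0)"
  by (simp add: message_poly_def coeff_digit_poly k)

lemma coeff_ebit_poly:
  "coeff (ebit_poly a) i =
     (if i < r then rep (qudit q i a) else 0) + (if i = r + h then rep (qudit q r a) else 0)"
  by (simp add: ebit_poly_def coeff_digit_poly)

lemma symbol_less: "symbol m t a j < q"
  by (simp add: symbol_def sym_less qudit_less q_pos)

lemma qudit_eq_if_diff_mem: "rep (qudit q i x) - rep (qudit q j y) \<in> M \<Longrightarrow> qudit q i x = qudit q j y"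
  by (intro rep_diff_mem qudit_less q_pos)

lemma message_eqI:
  assumes "m < q ^ K" "t < q ^ h" "m' < q ^ K" "t' < q ^ h"
    and *: "\<And>i. coeff (message_poly m t - message_poly m' t') i \<in> M"
  shows "m = m' \<and> t = t'"
proof
  show "m = m'"
  proof (rule qudit_eqI[OF assms(1,3)], rule qudit_eq_if_diff_mem)
    fix j assume "j < K"
    then show "rep (qudit q j m) - rep (qudit q j m') \<in> M"
      using *[of "h + j"] by (simp add: coeff_message_poly k)
  qed
  show "t = t'"
  proof (rule qudit_eqI[OF assms(2,4)], rule qudit_eq_if_diff_mem)
    fix j assume "j < h"
    then show "rep (qudit q j t) - rep (qudit q j t') \<in> M"
      using *[of j] by (simp add: coeff_message_poly)
  qed
qed

lemma symbol_eq_iff: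
  "j < q \<Longrightarrow> symbol m t a j = symbol m' t' a' j \<longleftrightarrow>
     poly (w * (message_poly m t - message_poly m' t') + (ebit_poly a - ebit_poly a')) (rep j) \<in> M"
  by (simp add: symbol_def sym_eq_iff algebra_simps)

lemma symbol_q_eq_iff:
  "symbol m t a q = symbol m' t' a' q \<longleftrightarrow>
     coeff (message_poly m t - message_poly m' t') (k - 1) +
       (rep (qudit q r a) - rep (qudit q r a')) \<in> M"
  by (simp add: symbol_def sym_eq_iff algebra_simps)

text \<open>With equal ebit values only \<open>w\<close> times the message difference remains, and
  \<open>w\<close> has no roots.\<close>

lemma symbol_same_ebit_eq_iff:
  "j < q \<Longrightarrow> symbol m t a j = symbol m' t' a j \<longleftrightarrow>
     poly (message_poly m t - message_poly m' t') (rep j) \<in> M"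
  using w_rep[of j] prime_mem mult_mem
  by (auto simp only: symbol_eq_iff diff_self add_0_right poly_mult)

text \<open>For fixed \<open>a\<close> this is an extended Reed-Solomon code of dimension
  \<open>k\<close> up to translation and nonzero factors: a message difference has at most
  \<open>k - 1\<close> roots, and at most \<open>k - 2\<close> if it also vanishes at
  infinity.\<close>

lemma distance:
  assumes "m < q ^ K" "t < q ^ h" "m' < q ^ K" "t' < q ^ h" "(m, t) \<noteq> (m', t')"
  shows "q - k + 2 \<le> card {j\<in>{..<q + 2}. symbol m t a j \<noteq> symbol m' t' a j}"
    (is "_ \<le> card ?N")
proof -
  define v where "v = message_poly m t - message_poly m' t'"
  define Z where "Z = {j\<in>{..<q}. symbol m t a j = symbol m' t' a j}"
  have Z: "Z \<subseteq> {..<q}" "card Z \<le> q"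
    by (auto simp: Z_def intro: order.trans[OF card_mono[of "{..<q}"]])
  have root: "poly v (rep j) \<in> M" if "j \<in> Z" for j
    using that symbol_same_ebit_eq_iff[of j] by (auto simp: Z_def v_def)
  have not_all: "\<not> (\<forall>i. coeff v i \<in> M)"
    using message_eqI[OF assms(1-4)] assms(5) by (auto simp: v_def)
  have high: "coeff v i \<in> M" if "i \<ge> k" for i
    using that k by (simp add: v_def coeff_message_poly)
  show ?thesis
  proof (cases "symbol m t a q = symbol m' t' a q")
    case True
    then have "coeff v (k - 1) \<in> M" by (simp add: symbol_q_eq_iff v_def)
    then have "coeff v i \<in> M" if "i \<ge> k - 1" for i
      using that high by (cases "i = k - 1") auto
    then have "card Z < k - 1"
      using coeffs_mem_if_roots_rep[OF Z(1) _ root, of "k - 1"] not_all by force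
    moreover have "card ({..<q} - Z) \<le> card ?N"
      by (rule card_mono) (auto simp: Z_def)
    then have "q - card Z \<le> card ?N" using Z by (simp add: card_Diff_subset finite_subset)
    ultimately show ?thesis using q by linarith
  next
    case False
    have "card Z < k"
      using coeffs_mem_if_roots_rep[OF Z(1) _ root high] not_all by force
    moreover have "card (insert q ({..<q} - Z)) \<le> card ?N"
      by (rule card_mono) (use False in \<open>auto simp: Z_def\<close>)
    then have "Suc (q - card Z) \<le> card ?N" using Z by (simp add: card_Diff_subset finite_subset)
    ultimately show ?thesis using q by linarith
  qed
qed

lemma coeff_message_diff_high:
  "i \<ge> k \<Longrightarrow> coeff (message_poly m t - message_poly m' t') i = 0"
  by (simp add: coeff_message_poly k)

lemma coeff_ebit_diff_high:
  "i \<ge> r \<Longrightarrow> i \<noteq> r + h \<Longrightarrow> coeff (ebit_poly a - ebit_poly a') i = 0"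
  by (simp add: coeff_ebit_poly)

text \<open>By \<open>delta\<close> the ebit part has degree below \<open>r\<close> modulo
  \<open>M\<close>, whereas \<open>w\<close> times a nonzero polynomial has degree at least
  \<open>r\<close>. Hence both parts vanish separately.\<close>

lemma all_eqI:
  assumes "m < q ^ K" "t < q ^ h" "m' < q ^ K" "t' < q ^ h" "a < q ^ (r + 2)" "a' < q ^ (r + 2)"
    and all: "\<And>i. coeff (w * (message_poly m t - message_poly m' t') + (ebit_poly a - ebit_poly a')) i \<in> M"
    and delta: "rep (qudit q r a) - rep (qudit q r a') \<in> M"
    and last: "qudit q (Suc r) a = qudit q (Suc r) a'"
  shows "m = m' \<and> t = t' \<and> a = a'"
proof -
  let ?v = "message_poly m t - message_poly m' t'" and ?b = "ebit_poly a - ebit_poly a'"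
  have bhigh: "coeff ?b i \<in> M" if "i \<ge> r" for i
    using delta that by (cases "i = r + h") (auto simp: coeff_ebit_poly)
  have "coeff ?v i \<in> M" for i
  proof (rule coeffs_mem_if_mult_mem[of w r 0])
    show "coeff (w * ?v) j \<in> M" if "j \<ge> r + 0" for j
      using diff_mem[OF all[of j] bhigh[of j]] that by simp
  qed (use degree_w coeff_w u in auto)
  note v = this
  have wv: "coeff (w * ?v) i \<in> M" for i
    unfolding coeff_mult by (intro sum_mem mult_mem v)
  have b: "coeff ?b i \<in> M" for i
    using diff_mem[OF all[of i] wv[of i]] by simp
  have "a = a'"
  proof (rule qudit_eqI[OF assms(5,6)])
    fix j assume "j < r + 2"
    then consider "j < r" | "j = r" | "j = Suc r" by linarith
    then show "qudit q j a = qudit q j a'"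
    proof cases
      case 1
      then have "rep (qudit q j a) - rep (qudit q j a') \<in> M"
        using b[of j] by (simp add: coeff_ebit_poly)
      then show ?thesis by (rule qudit_eq_if_diff_mem)
    qed (use delta last in \<open>auto intro: qudit_eq_if_diff_mem\<close>)
  qed
  then show ?thesis using message_eqI[OF assms(1-4) v] by simp
qed

lemma coeff_w_mult_high:
  assumes "\<And>j. j \<ge> s \<Longrightarrow> coeff v j = 0" "i \<ge> r + s"
  shows "coeff (w * v) i = 0"
  unfolding coeff_mult
proof (rule sum.neutral, rule ballI)
  fix j assume "j \<in> {..i}"
  show "coeff w j * coeff v (i - j) = 0"
    using assms degree_w by (cases "j \<le> r") (auto simp: coeff_eq_0)
qed

text \<open>The message and ebit parts add up to a polynomial of degree below \<open>q\<close>,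
  determined by its \<open>q\<close> values. The value at infinity then yields digit
  \<open>r\<close> of \<open>a\<close>.\<close>

lemma injective:
  assumes "m < q ^ K" "t < q ^ h" "m' < q ^ K" "t' < q ^ h" "a < q ^ (r + 2)" "a' < q ^ (r + 2)"
    and eq: "\<And>j. j < q + 2 \<Longrightarrow> symbol m t a j = symbol m' t' a' j"
  shows "m = m' \<and> t = t' \<and> a = a'"
proof -
  let ?v = "message_poly m t - message_poly m' t'" and ?b = "ebit_poly a - ebit_poly a'"
  let ?\<delta> = "rep (qudit q r a) - rep (qudit q r a')"
  have all: "coeff (w * ?v + ?b) i \<in> M" for i
  proof (rule coeffs_mem_if_roots_rep[of "{..<q}" q])
    show "poly (w * ?v + ?b) (rep j) \<in> M" if "j \<in> {..<q}" for j
      using eq[of j] that symbol_eq_iff[of j] by auto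
    show "coeff (w * ?v + ?b) j \<in> M" if "j \<ge> q" for j
    proof -
      have "coeff (w * ?v) j = 0"
        using that q by (intro coeff_w_mult_high[OF coeff_message_diff_high]) auto
      moreover have "coeff ?b j = 0"
        by (rule coeff_ebit_diff_high) (use that q k K in auto)
      ultimately show ?thesis by simp
    qed
  qed auto
  have vhigh: "coeff ?v j \<in> M" if "j > h" for j
  proof (rule coeffs_mem_if_mult_mem[of w r "Suc h"])
    show "coeff (w * ?v) i \<in> M" if "i \<ge> r + Suc h" for i
      using all[of i] coeff_ebit_diff_high[of i a a'] that by simp
  qed (use degree_w coeff_w u that in auto)
  have inf: "coeff ?v (k - 1) + ?\<delta> \<in> M"
    using eq[of q] by (simp only: symbol_q_eq_iff)
  have "coeff ?b (r + h) = ?\<delta>" by (simp add: coeff_ebit_poly)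
  then have "coeff (w * ?v) (r + h) + ?\<delta> \<in> M" using all[of "r + h"] by (simp only: coeff_add)
  from diff_mem[OF this coeff_mult_top[of w r h ?v, OF degree_w vhigh]]
  have top: "u * coeff ?v h + ?\<delta> \<in> M" by (simp add: coeff_w algebra_simps)
  \<comment> \<open>Write \<open>v_i\<close> for the coefficients of \<open>?v\<close>. Modulo
    \<open>M\<close>, degree \<open>r + h\<close> gives \<open>u v_h + \<delta> = 0\<close> and
    infinity gives \<open>v_(k-1) + \<delta> = 0\<close>. If \<open>k - 1 = h\<close>, subtraction
    leaves \<open>(u - 1) v_h = 0\<close>; otherwise \<open>k - 1 > h\<close> and
    \<open>v_(k-1)\<close> already vanishes.\<close>
  have "?\<delta> \<in> M"
  proof (cases "k - 1 = h")
    case True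
    have "(u - 1) * coeff ?v h \<in> M"
      using diff_mem[OF top inf] True by (simp add: algebra_simps)
    then have "coeff ?v h \<in> M" using prime_mem u(2) by blast
    then have "coeff ?v (k - 1) \<in> M" by (simp only: True)
    from diff_mem[OF inf this] show ?thesis by (simp only: add_diff_cancel_left')
  next
    case False
    then have "coeff ?v (k - 1) \<in> M" using k K by (intro vhigh) linarith
    from diff_mem[OF inf this] show ?thesis by (simp only: add_diff_cancel_left')
  qed
  moreover have "qudit q (Suc r) a = qudit q (Suc r) a'"
    using eq[of "Suc q"] by (simp add: symbol_def)
  ultimately show ?thesis using all by (intro all_eqI assms)
qed

text \<open>For fixed \<open>m\<close> the first \<open>q + 1\<close> symbols form a coset of the
  second code, which is MDS of dimension \<open>r + h + 1 = q - k + 1\<close>; any that many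
  positions determine its words. The unencoded half of an ebit is the remaining position of
  \<open>S'\<close>.\<close>

lemma strength:
  assumes "S \<subseteq> {..<q + 2}" "card S < q - k + 2"
  obtains S' where "S \<subseteq> S'" "S' \<subseteq> {..<q + 2}" "card S' = h + (r + 2)"
    "\<And>m t a t' a'. m < q ^ K \<Longrightarrow> t < q ^ h \<Longrightarrow> t' < q ^ h \<Longrightarrow> a < q ^ (r + 2) \<Longrightarrow> a' < q ^ (r + 2) \<Longrightarrow>
      (\<And>j. j \<in> S' \<Longrightarrow> symbol m t a j = symbol m t' a' j) \<Longrightarrow> t = t' \<and> a = a'"
proof -
  have finS: "finite S" using assms(1) finite_subset by blast
  have "card (S - {Suc q}) \<le> card S" using finS by (intro card_mono) auto
  then have "card (S - {Suc q}) \<le> r + h + 1" using assms(2) q by linarith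
  moreover have "S - {Suc q} \<subseteq> {..q}" using assms(1) by force
  ultimately obtain T where T: "S - {Suc q} \<subseteq> T" "T \<subseteq> {..q}" "card T = r + h + 1"
    using exists_subset_between[of "S - {Suc q}" "r + h + 1" "{..q}"] q k K by auto
  have finT: "finite T" using T(2) finite_subset by blast
  show ?thesis
  proof (rule that[of "insert (Suc q) T"])
    show "S \<subseteq> insert (Suc q) T" using T(1) by auto
    show "insert (Suc q) T \<subseteq> {..<q + 2}" using T(2) by auto
    have "Suc q \<notin> T" using T(2) by auto
    then show "card (insert (Suc q) T) = h + (r + 2)" using T(3) finT by simp
  next
    fix m t a t' a'
    assume range: "m < q ^ K" "t < q ^ h" "t' < q ^ h" "a < q ^ (r + 2)" "a' < q ^ (r + 2)"
      and eq: "\<And>j. j \<in> insert (Suc q) T \<Longrightarrow> symbol m t a j = symbol m t' a' j"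
    let ?v = "message_poly m t - message_poly m t'" and ?b = "ebit_poly a - ebit_poly a'"
    let ?\<delta> = "rep (qudit q r a) - rep (qudit q r a')"
    define Z where "Z = T - {q}"
    have Z: "Z \<subseteq> {..<q}" using T(2) by (force simp: Z_def)
    have root: "poly (w * ?v + ?b) (rep j) \<in> M" if "j \<in> Z" for j
      using eq[of j] that Z symbol_eq_iff[of j] by (auto simp: Z_def)
    have v: "coeff ?v j = 0" if "j \<ge> h" for j using that by (simp add: coeff_message_poly)
    have wv: "coeff (w * ?v) j = 0" if "j \<ge> r + h" for j
      using v that by (rule coeff_w_mult_high)
    have top: "coeff (w * ?v + ?b) (r + h) = ?\<delta>" using wv[of "r + h"] by (simp add: coeff_ebit_poly)
    have high: "coeff (w * ?v + ?b) j \<in> M" if "j > r + h" for j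
      using wv[of j] coeff_ebit_diff_high[of j a a'] that by simp
    have all: "coeff (w * ?v + ?b) i \<in> M" for i
    \<comment> \<open>If infinity lies in \<open>T\<close>, it removes degree \<open>r + h\<close>
      and leaves \<open>r + h\<close> finite points. Otherwise there are \<open>r + h + 1\<close>
      finite points for degree at most \<open>r + h\<close>.\<close>
    proof (cases "q \<in> T")
      case True
      have "coeff ?v (k - 1) + ?\<delta> \<in> M" using eq[of q] True symbol_q_eq_iff by blast
      moreover have "coeff ?v (k - 1) = 0" using k K by (intro v) linarith
      ultimately have "coeff (w * ?v + ?b) (r + h) \<in> M" by (simp only: top add_0_left)
      then have high': "coeff (w * ?v + ?b) j \<in> M" if "j \<ge> r + h" for j
        using that high[of j] by (cases "j = r + h") auto
      have "r + h \<le> card Z" using True T(3) finT by (simp add: Z_def)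
      then show ?thesis using root high' by (rule coeffs_mem_if_roots_rep[OF Z])
    next
      case False
      then have "Suc (r + h) \<le> card Z" using T(3) by (simp add: Z_def)
      then show ?thesis using root by (rule coeffs_mem_if_roots_rep[OF Z]) (simp_all only: high Suc_le_eq)
    qed
    moreover have "?\<delta> \<in> M" using all[of "r + h"] by (simp only: top)
    moreover have "qudit q (Suc r) a = qudit q (Suc r) a'"
      using eq[of "Suc q"] by (simp add: symbol_def)
    ultimately show "t = t' \<and> a = a'"
      using all_eqI[of m t m t' a a'] range by blast
  qed
qed

text \<open>Pigeonhole: there are \<open>q^k\<close> pairs \<open>(m, t)\<close> but only
  \<open>q^(k-1)\<close> patterns on the first \<open>k - 1\<close> positions. Two words agreeing
  there, and in the last symbol by equality of \<open>a\<close>, differ in at most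
  \<open>q - k + 2\<close> positions.\<close>

lemma distance_attained:
  obtains m t m' t' where "m < q ^ K" "t < q ^ h" "m' < q ^ K" "t' < q ^ h" "m \<noteq> m'"
    "card {j\<in>{..<q + 2}. symbol m t 0 j \<noteq> symbol m' t' 0 j} \<le> q - k + 2"
proof -
  define \<Phi> where "\<Phi> = (\<lambda>(m, t). restrict (symbol m t 0) {..<k - 1})"
  let ?A = "{..<q ^ K} \<times> {..<q ^ h}" and ?B = "{..<k - 1} \<rightarrow>\<^sub>E {..<q}"
  have kq: "k - 1 \<le> q" using q by simp
  have q1: "q > 1" using q r by simp
  have "k - 1 < k" using k K by simp
  then have "card ?B < card ?A"
    using q1 by (simp add: card_PiE k power_add[symmetric] add.commute)
  moreover have "\<Phi> ` ?A \<subseteq> ?B" using symbol_less by (force simp: \<Phi>_def PiE_iff)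
  then have "card (\<Phi> ` ?A) \<le> card ?B" by (intro card_mono finite_PiE) auto
  ultimately have "\<not> inj_on \<Phi> ?A" using card_image by force
  then obtain m t m' t' where range: "m < q ^ K" "t < q ^ h" "m' < q ^ K" "t' < q ^ h"
    and ne: "(m, t) \<noteq> (m', t')" and "\<Phi> (m, t) = \<Phi> (m', t')"
    by (auto simp: inj_on_def)
  then have eq: "symbol m t 0 j = symbol m' t' 0 j" if "j < k - 1" for j
    using that unfolding \<Phi>_def by (auto dest: fun_cong[of _ _ j])
  \<comment> \<open>Otherwise the message difference would have degree below
    \<open>h \<le> k - 1\<close> and \<open>k - 1\<close> roots.\<close>
  have "m \<noteq> m'"
  proof
    assume m: "m = m'"
    let ?v = "message_poly m t - message_poly m' t'"
    have "coeff ?v i \<in> M" for i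
    proof (rule coeffs_mem_if_roots_rep[of "{..<k - 1}" h])
      show "poly ?v (rep j) \<in> M" if "j \<in> {..<k - 1}" for j
        using that eq[of j] kq by (simp add: symbol_same_ebit_eq_iff)
      show "coeff ?v j \<in> M" if "j \<ge> h" for j
        using that m by (simp add: coeff_message_poly)
    qed (use kq k K in auto)
    then show False using message_eqI[OF range] ne by blast
  qed
  moreover have "card {j\<in>{..<q + 2}. symbol m t 0 j \<noteq> symbol m' t' 0 j} \<le> card {k - 1..q}"
  proof (rule card_mono, simp, rule subsetI)
    fix j assume j: "j \<in> {j\<in>{..<q + 2}. symbol m t 0 j \<noteq> symbol m' t' 0 j}"
    then have "j \<noteq> Suc q" by (auto simp: symbol_def)
    moreover have "\<not> j < k - 1" using j eq by blast
    ultimately show "j \<in> {k - 1..q}" using j by auto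
  qed
  then have "card {j\<in>{..<q + 2}. symbol m t 0 j \<noteq> symbol m' t' 0 j} \<le> q - k + 2"
    using q k K by simp
  ultimately show ?thesis using range that by blast
qed

end

section \<open>Entanglement-assisted codes from families of words\<close>

lemma sum_lessThan_mult:
  fixes f :: "nat \<Rightarrow> 'a :: comm_monoid_add"
  shows "(\<Sum>j<N * C. f j) = (\<Sum>x<N. \<Sum>b<C. f (x * C + b))"
proof -
  have "(\<Sum>j = x * C..<x * C + C. f j) = (\<Sum>b<C. f (x * C + b))" for x
    using sum.shift_bounds_nat_ivl[of f 0 "x * C" C]
    by (simp add: atLeast0LessThan add.commute)
  then show ?thesis using sum.nat_group[of f C N] by simp
qed

lemma mult_add_less:
  fixes x b N C :: nat
  assumes "x < N" "b < C"
  shows "x * C + b < N * C"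
proof -
  have "(x + 1) * C \<le> N * C" using assms(1) by (intro mult_le_mono1) simp
  then show ?thesis using assms(2) by simp
qed

lemma mult_add_div_mod:
  fixes x b C :: nat
  assumes "b < C"
  shows "(x * C + b) div C = x" "(x * C + b) mod C = b"
  using assms by auto

lemma mat_adjoint_dim [simp]:
  "dim_row (mat_adjoint A) = dim_col A" "dim_col (mat_adjoint A) = dim_row A"
  by (simp_all add: mat_adjoint_def)

lemma mat_adjoint_carrier [simp]: "A \<in> carrier_mat m n \<Longrightarrow> mat_adjoint A \<in> carrier_mat n m"
  by (auto simp: mat_adjoint_def)

lemma mat_adjoint_index:
  "A \<in> carrier_mat m n \<Longrightarrow> i < n \<Longrightarrow> j < m \<Longrightarrow> mat_adjoint A $$ (i, j) = conjugate (A $$ (j, i))"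
  by (auto simp: mat_adjoint_def mat_of_rows_def)

lemma mult_mat_index:
  "A \<in> carrier_mat a b \<Longrightarrow> B \<in> carrier_mat b c \<Longrightarrow> i < a \<Longrightarrow> j < c \<Longrightarrow>
     (A * B) $$ (i, j) = (\<Sum>k<b. A $$ (i, k) * B $$ (k, j))"
  by (auto simp: scalar_prod_def atLeast0LessThan)

lemma mult_mat_vec_index:
  "A \<in> carrier_mat a b \<Longrightarrow> v \<in> carrier_vec b \<Longrightarrow> i < a \<Longrightarrow>
     (A *\<^sub>v v) $ i = (\<Sum>k<b. A $$ (i, k) * v $ k)"
  by (auto simp: scalar_prod_def atLeast0LessThan)

lemma tensor_one_index:
  assumes "A \<in> carrier_mat a b" "x < a" "y < b" "i < C" "j < C"
  shows "tensor_mat A (1\<^sub>m C) $$ (x * C + i, y * C + j) = (if i = j then A $$ (x, y) else 0)"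
  using assms mult_add_less[of x a i C] mult_add_less[of y b j C]
  by (auto simp: tensor_mat_def)

lemma tensor_one_carrier:
  "A \<in> carrier_mat a b \<Longrightarrow> tensor_mat A (1\<^sub>m C) \<in> carrier_mat (a * C) (b * C)"
  by (auto simp: tensor_mat_def)

lemma tensor_ebits_index:
  assumes "\<psi> \<in> carrier_vec L" "m < L" "a < q ^ c" "b < q ^ c"
  shows "tensor_vec \<psi> (ebits q c) $ ((m * q ^ c + a) * q ^ c + b) =
    (if a = b then \<psi> $ m * complex_of_real (1 / sqrt (real (q ^ c))) else 0)"
proof -
  define C where "C = q ^ c"
  let ?i = "(m * C + a) * C + b"
  have a: "a < C" "b < C" using assms by (simp_all add: C_def)
  have i: "?i = m * (C * C) + (a * C + b)" by (simp add: algebra_simps)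
  have ab: "a * C + b < C * C" by (rule mult_add_less[OF a])
  have "?i div (C * C) = m" "?i mod (C * C) = a * C + b"
    unfolding i using ab by (simp_all add: mult_add_div_mod)
  moreover have "?i < L * (C * C)" unfolding i by (rule mult_add_less[OF assms(2) ab])
  moreover have "(a * C + b) div C = a" "(a * C + b) mod C = b" using a by auto
  ultimately show ?thesis
    using assms ab unfolding tensor_vec_def ebits_def by (auto simp flip: C_def)
qed

text \<open>The encoder sends message \<open>m\<close> and ebit input \<open>a\<close> to the
  uniform superposition over \<open>t\<close> of the words \<open>word m t a\<close>. Injectivity
  makes it an isometry, distance kills the off-diagonal matrix elements of small errors, strength
  makes the diagonal ones independent of \<open>m\<close>, and the last condition supplies an
  undetected error.\<close>

locale word_code =
  fixes q n K h c d :: nat and word :: "nat \<Rightarrow> nat \<Rightarrow> nat \<Rightarrow> nat"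
  assumes q_pos: "q > 0"
    and word_less: "m < q ^ K \<Longrightarrow> t < q ^ h \<Longrightarrow> a < q ^ c \<Longrightarrow> word m t a < q ^ n"
    and word_inject: "m < q ^ K \<Longrightarrow> t < q ^ h \<Longrightarrow> a < q ^ c \<Longrightarrow>
      m' < q ^ K \<Longrightarrow> t' < q ^ h \<Longrightarrow> a' < q ^ c \<Longrightarrow>
      word m t a = word m' t' a' \<Longrightarrow> m = m' \<and> t = t' \<and> a = a'"
    and word_distance: "m < q ^ K \<Longrightarrow> t < q ^ h \<Longrightarrow> m' < q ^ K \<Longrightarrow> t' < q ^ h \<Longrightarrow> a < q ^ c \<Longrightarrow>
      (m, t) \<noteq> (m', t') \<Longrightarrow>
      d \<le> card {j\<in>{..<n}. qudit q j (word m t a) \<noteq> qudit q j (word m' t' a)}"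
    and word_strength: "S \<subseteq> {..<n} \<Longrightarrow> card S < d \<Longrightarrow>
      \<exists>S'. S \<subseteq> S' \<and> S' \<subseteq> {..<n} \<and> card S' = h + c \<and>
        (\<forall>m<q ^ K. \<forall>t<q ^ h. \<forall>t'<q ^ h. \<forall>a<q ^ c. \<forall>a'<q ^ c.
          (\<forall>j\<in>S'. qudit q j (word m t a) = qudit q j (word m t' a')) \<longrightarrow> t = t' \<and> a = a')"
    and word_distance_attained: "\<exists>m<q ^ K. \<exists>t<q ^ h. \<exists>m'<q ^ K. \<exists>t'<q ^ h. \<exists>a<q ^ c. m \<noteq> m' \<and>
      card {j\<in>{..<n}. qudit q j (word m t a) \<noteq> qudit q j (word m' t' a)} \<le> d"
begin

abbreviation "C \<equiv> q ^ c"
abbreviation "H \<equiv> q ^ h"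
abbreviation "L \<equiv> q ^ K"
abbreviation "N \<equiv> q ^ n"

definition \<alpha> :: complex where "\<alpha> = complex_of_real (1 / sqrt (real H))"

definition \<beta> :: complex where "\<beta> = complex_of_real (1 / sqrt (real C))"

definition amp :: "nat \<Rightarrow> nat \<Rightarrow> nat \<Rightarrow> complex" where
  "amp m a x = (\<Sum>t<H. if word m t a = x then \<alpha> else 0)"

definition V :: "complex mat" where
  "V = mat N (q ^ (K + c)) (\<lambda>(x, y). amp (y div C) (y mod C) x)"

text \<open>Column \<open>m\<close> of \<open>B\<close> is the encoded basis state \<open>|m>\<close>.\<close>

definition B :: "complex mat" where
  "B = mat (N * C) L (\<lambda>(i, m). \<beta> * amp m (i mod C) (i div C))"

lemma cnj_\<alpha>: "cnj \<alpha> = \<alpha>" and cnj_\<beta>: "cnj \<beta> = \<beta>"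
  by (simp_all add: \<alpha>_def \<beta>_def)

lemma \<alpha>_square: "of_nat H * (\<alpha> * \<alpha>) = 1" and \<beta>_square: "of_nat C * (\<beta> * \<beta>) = 1"
proof -
  have "of_nat x * (complex_of_real (1 / sqrt (real x)) * complex_of_real (1 / sqrt (real x))) = 1"
    if "x > 0" for x
  proof -
    have "real x * (1 / sqrt (real x) * (1 / sqrt (real x))) = 1" using that by simp
    then show ?thesis by (metis of_real_1 of_real_mult of_real_of_nat_eq)
  qed
  then show "of_nat H * (\<alpha> * \<alpha>) = 1" "of_nat C * (\<beta> * \<beta>) = 1"
    using q_pos by (simp_all only: \<alpha>_def \<beta>_def zero_less_power)
qed

lemma cnj_amp: "cnj (amp m a x) = amp m a x"
  unfolding amp_def cnj_sum by (intro sum.cong) (auto simp: cnj_\<alpha>)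

lemma sum_amp_mult:
  assumes "m < L" "a < C"
  shows "(\<Sum>x<N. amp m a x * g x) = (\<Sum>t<H. \<alpha> * g (word m t a))"
proof -
  have "(\<Sum>x<N. amp m a x * g x) = (\<Sum>x<N. \<Sum>t<H. if word m t a = x then \<alpha> * g x else 0)"
    unfolding amp_def sum_distrib_right by (intro sum.cong) auto
  also have "\<dots> = (\<Sum>t<H. \<Sum>x<N. if word m t a = x then \<alpha> * g x else 0)"
    by (rule sum.swap)
  also have "\<dots> = (\<Sum>t<H. \<alpha> * g (word m t a))"
    using assms word_less by (intro sum.cong) auto
  finally show ?thesis .
qed

lemma amp_orthonormal:
  assumes "m < L" "a < C" "m' < L" "a' < C"
  shows "(\<Sum>x<N. amp m a x * amp m' a' x) = (if m = m' \<and> a = a' then 1 else 0)"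
proof -
  have "amp m' a' (word m t a) = (if m = m' \<and> a = a' then \<alpha> else 0)" if "t < H" for t
  proof -
    have "amp m' a' (word m t a) = (\<Sum>t'<H. if t' = t then (if m = m' \<and> a = a' then \<alpha> else 0) else 0)"
      unfolding amp_def using word_inject[OF assms(3) _ assms(4) assms(1) that assms(2)]
      by (intro sum.cong) auto
    then show ?thesis using that by simp
  qed
  then show ?thesis
    using \<alpha>_square by (simp add: sum_amp_mult[OF assms(1,2)])
qed

lemma V_carrier: "V \<in> carrier_mat N (q ^ (K + c))"
  by (simp add: V_def)

lemma B_carrier [simp]: "B \<in> carrier_mat (N * C) L"
  by (simp add: B_def)

lemma V_index: "x < N \<Longrightarrow> m < L \<Longrightarrow> a < C \<Longrightarrow> V $$ (x, m * C + a) = amp m a x"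
  using mult_add_less[of m L a C] by (simp add: V_def power_add mult_add_div_mod)

lemma B_index: "x < N \<Longrightarrow> a < C \<Longrightarrow> m < L \<Longrightarrow> B $$ (x * C + a, m) = \<beta> * amp m a x"
  using mult_add_less[of x N a C] by (simp add: B_def mult_add_div_mod)

lemma encoding_isometry: "encoding_isometry q n K c V"
proof -
  have "mat_adjoint V * V = 1\<^sub>m (q ^ (K + c))"
  proof (rule eq_matI)
    fix i j assume "i < dim_row (1\<^sub>m (q ^ (K + c)) :: complex mat)"
      "j < dim_col (1\<^sub>m (q ^ (K + c)) :: complex mat)"
    then have ij: "i < q ^ (K + c)" "j < q ^ (K + c)" by simp_all
    have C: "C > 0" using q_pos by simp
    have div: "i div C < L" "j div C < L"
      using ij by (simp_all add: power_add less_mult_imp_div_less)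
    have "(mat_adjoint V * V) $$ (i, j) = (\<Sum>x<N. cnj (V $$ (x, i)) * V $$ (x, j))"
      using ij mult_mat_index[OF mat_adjoint_carrier[OF V_carrier] V_carrier ij]
      by (simp add: mat_adjoint_index[OF V_carrier])
    also have "\<dots> = (\<Sum>x<N. amp (i div C) (i mod C) x * amp (j div C) (j mod C) x)"
      using ij by (intro sum.cong) (simp_all add: V_def cnj_amp)
    also have "\<dots> = (if i div C = j div C \<and> i mod C = j mod C then 1 else 0)"
      using C div by (intro amp_orthonormal) auto
    also have "(i div C = j div C \<and> i mod C = j mod C) = (i = j)"
      by (metis div_mult_mod_eq)
    finally show "(mat_adjoint V * V) $$ (i, j) = 1\<^sub>m (q ^ (K + c)) $$ (i, j)"
      using ij by simp
  qed (simp_all add: V_def)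
  then show ?thesis using V_carrier by (simp add: encoding_isometry_def)
qed

lemma B_isometry: "mat_adjoint B * B = 1\<^sub>m L"
proof (rule eq_matI)
  fix m m' assume "m < dim_row (1\<^sub>m L :: complex mat)" "m' < dim_col (1\<^sub>m L :: complex mat)"
  then have m: "m < L" "m' < L" by simp_all
  have "(mat_adjoint B * B) $$ (m, m') = (\<Sum>i<N * C. cnj (B $$ (i, m)) * B $$ (i, m'))"
    using mult_mat_index[OF mat_adjoint_carrier[OF B_carrier] B_carrier m] m
    by (simp add: mat_adjoint_index[OF B_carrier])
  also have "\<dots> = (\<Sum>x<N. \<Sum>a<C. \<beta> * \<beta> * (amp m a x * amp m' a x))"
    unfolding sum_lessThan_mult using m
    by (intro sum.cong) (simp_all add: B_index cnj_amp cnj_\<beta>)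
  also have "\<dots> = (\<Sum>a<C. \<beta> * \<beta> * (\<Sum>x<N. amp m a x * amp m' a x))"
    by (subst sum.swap) (simp add: sum_distrib_left)
  also have "\<dots> = (\<Sum>a<C. \<beta> * \<beta> * (if m = m' then 1 else 0))"
    using m by (intro sum.cong) (simp_all add: amp_orthonormal)
  also have "\<dots> = (if m = m' then 1 else 0)" using \<beta>_square by simp
  finally show "(mat_adjoint B * B) $$ (m, m') = 1\<^sub>m L $$ (m, m')" using m by simp
qed (simp_all add: B_def)

text \<open>The identity on the receiver's register and the diagonal form of the ebit state collapse
  the sums to equal indices, so \<open>B\<close> parametrises the code space directly.\<close>

lemma encode:
  assumes "\<psi> \<in> carrier_vec L"
  shows "tensor_mat V (1\<^sub>m C) *\<^sub>v tensor_vec \<psi> (ebits q c) = B *\<^sub>v \<psi>"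
proof (rule eq_vecI)
  have V1: "tensor_mat V (1\<^sub>m C) \<in> carrier_mat (N * C) (q ^ (K + c) * C)"
    using V_carrier by (rule tensor_one_carrier)
  have T: "tensor_vec \<psi> (ebits q c) \<in> carrier_vec (q ^ (K + c) * C)"
    using assms by (simp add: tensor_vec_def ebits_def power_add)
  fix i assume "i < dim_vec (B *\<^sub>v \<psi>)"
  then have i: "i < N * C" by (simp add: B_def)
  define x b where "x = i div C" and "b = i mod C"
  have x: "x < N" using i by (simp add: x_def less_mult_imp_div_less)
  have b: "b < C" using q_pos by (simp add: b_def)
  have i_eq: "i = x * C + b" unfolding x_def b_def by (rule div_mult_mod_eq[symmetric])
  have "(tensor_mat V (1\<^sub>m C) *\<^sub>v tensor_vec \<psi> (ebits q c)) $ i =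
      (\<Sum>y<q ^ (K + c) * C. tensor_mat V (1\<^sub>m C) $$ (i, y) * tensor_vec \<psi> (ebits q c) $ y)"
    using V1 T i by (rule mult_mat_vec_index)
  also have "\<dots> = (\<Sum>y<q ^ (K + c). \<Sum>b'<C. if b' = b then
      V $$ (x, y) * tensor_vec \<psi> (ebits q c) $ (y * C + b) else 0)"
    unfolding sum_lessThan_mult using x b
    by (intro sum.cong) (auto simp: i_eq tensor_one_index[OF V_carrier])
  also have "\<dots> = (\<Sum>y<L * C. V $$ (x, y) * tensor_vec \<psi> (ebits q c) $ (y * C + b))"
    using b by (simp add: power_add)
  also have "\<dots> = (\<Sum>m<L. \<Sum>a<C. if a = b then \<beta> * amp m b x * \<psi> $ m else 0)"
    unfolding sum_lessThan_mult using x b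
    by (intro sum.cong) (auto simp: V_index tensor_ebits_index[OF assms] \<beta>_def)
  also have "\<dots> = (\<Sum>m<L. B $$ (i, m) * \<psi> $ m)"
    using x b by (simp add: i_eq B_index)
  also have "\<dots> = (B *\<^sub>v \<psi>) $ i"
    using B_carrier assms i by (rule mult_mat_vec_index[symmetric])
  finally show "(tensor_mat V (1\<^sub>m C) *\<^sub>v tensor_vec \<psi> (ebits q c)) $ i = (B *\<^sub>v \<psi>) $ i" .
qed (simp add: tensor_mat_def V_def B_def)

lemma code_space_eq: "code_space q K c V = {B *\<^sub>v \<psi> |\<psi>. \<psi> \<in> carrier_vec L}"
  unfolding code_space_def by (intro Collect_cong ex_cong1) (use encode in auto)

definition P :: "complex mat" where "P = B * mat_adjoint B"

lemma Bd_carrier [simp]: "mat_adjoint B \<in> carrier_mat L (N * C)"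
  by simp

lemma P_carrier [simp]: "P \<in> carrier_mat (N * C) (N * C)"
  unfolding P_def using B_carrier Bd_carrier by (rule mult_carrier_mat)

lemma PB: "P * B = B"
proof -
  have "P * B = B * (mat_adjoint B * B)"
    unfolding P_def by (rule assoc_mult_mat) (rule B_carrier Bd_carrier)+
  then show ?thesis using B_isometry B_carrier by simp
qed

lemma projector: "projector_onto (N * C) P (code_space q K c V)"
  unfolding projector_onto_def
proof (intro conjI)
  show "mat_adjoint P = P"
  proof (rule eq_matI)
    fix i j assume "i < dim_row P" "j < dim_col P"
    then have ij: "i < N * C" "j < N * C" using P_carrier by auto
    have P: "P $$ (i, j) = (\<Sum>k<L. B $$ (i, k) * cnj (B $$ (j, k)))"
      if "i < N * C" "j < N * C" for i j
      unfolding P_def using mult_mat_index[OF B_carrier Bd_carrier that] that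
      by (simp add: mat_adjoint_index[OF B_carrier])
    show "mat_adjoint P $$ (i, j) = P $$ (i, j)"
      using ij by (simp add: mat_adjoint_index[OF P_carrier] P mult.commute)
  qed (use carrier_matD[OF P_carrier] in simp_all)
  have "P * P = P * (B * mat_adjoint B)" by (simp only: P_def)
  also have "\<dots> = P * B * mat_adjoint B"
    by (rule assoc_mult_mat[symmetric]) (rule P_carrier B_carrier Bd_carrier)+
  finally have "P * P = P * B * mat_adjoint B" .
  then show "P * P = P" by (simp only: PB P_def[symmetric])
  show "{P *\<^sub>v v |v. v \<in> carrier_vec (N * C)} = code_space q K c V"
    unfolding code_space_eq
  proof safe
    fix v :: "complex vec" assume v: "v \<in> carrier_vec (N * C)"
    have "P *\<^sub>v v = B *\<^sub>v (mat_adjoint B *\<^sub>v v)"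
      unfolding P_def using B_carrier Bd_carrier v by (rule assoc_mult_mat_vec)
    moreover have "mat_adjoint B *\<^sub>v v \<in> carrier_vec L"
      using Bd_carrier v by (rule mult_mat_vec_carrier)
    ultimately show "\<exists>\<psi>. P *\<^sub>v v = B *\<^sub>v \<psi> \<and> \<psi> \<in> carrier_vec L" by blast
  next
    fix \<psi> :: "complex vec" assume \<psi>: "\<psi> \<in> carrier_vec L"
    have "P *\<^sub>v (B *\<^sub>v \<psi>) = (P * B) *\<^sub>v \<psi>"
      using P_carrier B_carrier \<psi> by (rule assoc_mult_mat_vec[symmetric])
    then have "B *\<^sub>v \<psi> = P *\<^sub>v (B *\<^sub>v \<psi>)" by (simp add: PB)
    moreover have "B *\<^sub>v \<psi> \<in> carrier_vec (N * C)"
      using B_carrier \<psi> by (rule mult_mat_vec_carrier)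
    ultimately show "\<exists>v. B *\<^sub>v \<psi> = P *\<^sub>v v \<and> v \<in> carrier_vec (N * C)" by blast
  qed
qed simp

section \<open>Detection of errors and the minimum distance\<close>

text \<open>As \<open>B\<close> is an isometry and \<open>P\<close> is \<open>B\<close> times its
  adjoint, compressing by \<open>B\<close> loses no information. This is the Knill-Laflamme
  condition in the encoded basis.\<close>

lemma detects_iff:
  assumes E: "E \<in> carrier_mat N N"
  shows "detects q c P E \<longleftrightarrow>
    (\<exists>a. mat_adjoint B * (tensor_mat E (1\<^sub>m C) * B) = a \<cdot>\<^sub>m 1\<^sub>m L)"
proof -
  define T where "T = tensor_mat E (1\<^sub>m C)"
  let ?Bd = "mat_adjoint B" and ?G = "mat_adjoint B * (T * B)"
  have T: "T \<in> carrier_mat (N * C) (N * C)"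
    unfolding T_def using E by (rule tensor_one_carrier)
  note carr = T B_carrier Bd_carrier P_carrier
  have TB: "T * B \<in> carrier_mat (N * C) L" by (rule mult_carrier_mat[OF T B_carrier])
  have G: "?G \<in> carrier_mat L L" by (rule mult_carrier_mat[OF Bd_carrier TB])
  have 1: "P * T * P = B * ?G * ?Bd"
  proof -
    have "P * T * P = P * T * (B * ?Bd)" by (simp only: P_def)
    also have "\<dots> = P * T * B * ?Bd"
      by (rule assoc_mult_mat[symmetric], rule mult_carrier_mat) (rule carr)+
    also have "P * T * B = P * (T * B)" by (rule assoc_mult_mat) (rule carr)+
    also have "\<dots> = B * ?G" unfolding P_def by (rule assoc_mult_mat) (rule B_carrier Bd_carrier TB)+
    finally show ?thesis .
  qed
  have 2: "?Bd * (B * X * ?Bd) * B = X" if X: "X \<in> carrier_mat L L" for X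
  proof -
    have BX: "B * X \<in> carrier_mat (N * C) L" by (rule mult_carrier_mat[OF B_carrier X])
    have "?Bd * (B * X * ?Bd) = ?Bd * (B * X) * ?Bd"
      by (rule assoc_mult_mat[symmetric]) (rule Bd_carrier BX)+
    also have "?Bd * (B * X) = ?Bd * B * X"
      by (rule assoc_mult_mat[symmetric]) (rule Bd_carrier B_carrier X)+
    also have "\<dots> = X" using X by (simp add: B_isometry)
    finally have "?Bd * (B * X * ?Bd) * B = X * ?Bd * B" by simp
    also have "\<dots> = X * (?Bd * B)" by (rule assoc_mult_mat) (rule X Bd_carrier B_carrier)+
    also have "\<dots> = X" using X by (simp add: B_isometry)
    finally show ?thesis .
  qed
  have 3: "B * (a \<cdot>\<^sub>m 1\<^sub>m L) * ?Bd = a \<cdot>\<^sub>m P" for a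
  proof -
    have "B * (a \<cdot>\<^sub>m 1\<^sub>m L) = a \<cdot>\<^sub>m B"
      using mult_smult_distrib[OF B_carrier one_carrier_mat, of a] B_carrier by simp
    then show ?thesis unfolding P_def
      using mult_smult_assoc_mat[OF B_carrier Bd_carrier, of a] by simp
  qed
  have "P * T * P = a \<cdot>\<^sub>m P \<longleftrightarrow> ?G = a \<cdot>\<^sub>m 1\<^sub>m L" for a
  proof
    assume "P * T * P = a \<cdot>\<^sub>m P"
    then have "B * ?G * ?Bd = B * (a \<cdot>\<^sub>m 1\<^sub>m L) * ?Bd" by (simp only: 1 3)
    then have "?Bd * (B * ?G * ?Bd) * B = ?Bd * (B * (a \<cdot>\<^sub>m 1\<^sub>m L) * ?Bd) * B" by (simp only:)
    then show "?G = a \<cdot>\<^sub>m 1\<^sub>m L"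
      by (simp only: 2[OF G] 2[OF smult_carrier_mat[OF one_carrier_mat]])
  next
    assume "?G = a \<cdot>\<^sub>m 1\<^sub>m L"
    then show "P * T * P = a \<cdot>\<^sub>m P" by (simp only: 1 3)
  qed
  then show ?thesis unfolding detects_def T_def by (simp only:)
qed

text \<open>The error is the identity on the receiver's halves, so the row and column words share
  the same \<open>a\<close>.\<close>

lemma matrix_element:
  assumes E: "E \<in> carrier_mat N N" and m: "m' < L" "m < L"
  shows "(mat_adjoint B * (tensor_mat E (1\<^sub>m C) * B)) $$ (m', m) =
    \<beta> * \<beta> * \<alpha> * \<alpha> * (\<Sum>a<C. \<Sum>t'<H. \<Sum>t<H. E $$ (word m' t' a, word m t a))"
proof -
  define T where "T = tensor_mat E (1\<^sub>m C)"
  have T: "T \<in> carrier_mat (N * C) (N * C)"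
    unfolding T_def using E by (rule tensor_one_carrier)
  have TB: "T * B \<in> carrier_mat (N * C) L" by (rule mult_carrier_mat[OF T B_carrier])
  have TBi: "(T * B) $$ (x * C + a, m) = \<beta> * (\<Sum>t<H. \<alpha> * E $$ (x, word m t a))"
    if x: "x < N" "a < C" for x a
  proof -
    have "(T * B) $$ (x * C + a, m) = (\<Sum>j<N * C. T $$ (x * C + a, j) * B $$ (j, m))"
      by (rule mult_mat_index[OF T B_carrier mult_add_less[OF x] m(2)])
    also have "\<dots> = (\<Sum>y<N. \<Sum>b<C. if b = a then E $$ (x, y) * (\<beta> * amp m a y) else 0)"
      unfolding sum_lessThan_mult T_def using x m
      by (intro sum.cong) (auto simp: tensor_one_index[OF E] B_index)
    also have "\<dots> = \<beta> * (\<Sum>y<N. amp m a y * E $$ (x, y))"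
      using x by (simp add: sum_distrib_left mult_ac)
    also have "\<dots> = \<beta> * (\<Sum>t<H. \<alpha> * E $$ (x, word m t a))"
      using x m by (simp add: sum_amp_mult)
    finally show ?thesis .
  qed
  have "(mat_adjoint B * (T * B)) $$ (m', m) = (\<Sum>i<N * C. cnj (B $$ (i, m')) * (T * B) $$ (i, m))"
    using mult_mat_index[OF Bd_carrier TB m] m by (simp add: mat_adjoint_index[OF B_carrier])
  also have "\<dots> = (\<Sum>x<N. \<Sum>a<C. amp m' a x * (\<beta> * \<beta> * (\<Sum>t<H. \<alpha> * E $$ (x, word m t a))))"
    unfolding sum_lessThan_mult using m
    by (intro sum.cong) (simp_all add: B_index TBi cnj_amp cnj_\<beta> mult_ac)
  also have "\<dots> = (\<Sum>a<C. \<Sum>x<N. amp m' a x * (\<beta> * \<beta> * (\<Sum>t<H. \<alpha> * E $$ (x, word m t a))))"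
    by (rule sum.swap)
  also have "\<dots> = (\<Sum>a<C. \<Sum>t'<H. \<alpha> * (\<beta> * \<beta> * (\<Sum>t<H. \<alpha> * E $$ (word m' t' a, word m t a))))"
    by (rule sum.cong[OF refl], rule sum_amp_mult) (use m in auto)
  also have "\<dots> = \<beta> * \<beta> * \<alpha> * \<alpha> * (\<Sum>a<C. \<Sum>t'<H. \<Sum>t<H. E $$ (word m' t' a, word m t a))"
    by (simp add: sum_distrib_left mult_ac)
  finally show ?thesis unfolding T_def .
qed

text \<open>An entry of \<open>E\<close> vanishes unless its two words agree outside
  \<open>S\<close>, and distinct words with the same \<open>a\<close> differ in at least
  \<open>d > card S\<close> positions. What remains is a diagonal sum, shown to be the same for all
  \<open>m\<close>.\<close>

lemma detects_if_small_support:
  assumes S: "S \<subseteq> {..<n}" "card S < d" and "acts_within q n S E"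
  shows "detects q c P E"
proof -
  define Q where "Q F \<longleftrightarrow> (\<forall>x<N. \<forall>y<N. E $$ (x, y) =
      (if \<forall>j\<in>{..<n} - S. qudit q j x = qudit q j y
        then F (\<lambda>j. if j \<in> S then qudit q j x else 0) (\<lambda>j. if j \<in> S then qudit q j y else 0)
        else 0))" for F :: "(nat \<Rightarrow> nat) \<Rightarrow> (nat \<Rightarrow> nat) \<Rightarrow> complex"
  have "E \<in> carrier_mat N N \<and> (\<exists>F. Q F)"
    using assms(3) unfolding acts_within_def Q_def .
  then obtain F where E: "E \<in> carrier_mat N N" and "Q F" by blast
  note F = \<open>Q F\<close>[unfolded Q_def]
  obtain S' where S': "S \<subseteq> S'" "S' \<subseteq> {..<n}" "card S' = h + c"
    and inj: "\<forall>m<L. \<forall>t<H. \<forall>t'<H. \<forall>a<C. \<forall>a'<C.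
      (\<forall>j\<in>S'. qudit q j (word m t a) = qudit q j (word m t' a')) \<longrightarrow> t = t' \<and> a = a'"
    using word_strength[OF S] by (elim exE conjE) (rule that)
  have finS': "finite S'" using S'(2) finite_subset by blast
  \<comment> \<open>A diagonal entry of \<open>E\<close> depends only on the digits in
    \<open>S\<close>, hence only on the pattern on \<open>S'\<close>; \<open>tr\<close> sums it over
    all patterns.\<close>
  define D where "D v = (let s = (\<lambda>j. if j \<in> S then v j else 0) in F s s)" for v :: "nat \<Rightarrow> nat"
  define tr where "tr = (\<Sum>v\<in>S' \<rightarrow>\<^sub>E {..<q}. D v)"
  have offdiag: "E $$ (word m' t' a, word m t a) = 0"
    if r: "m < L" "t < H" "m' < L" "t' < H" "a < C" and "(m', t') \<noteq> (m, t)" for m t m' t' a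
  proof -
    have "\<not> (\<forall>j\<in>{..<n} - S. qudit q j (word m' t' a) = qudit q j (word m t a))"
    proof
      assume "\<forall>j\<in>{..<n} - S. qudit q j (word m' t' a) = qudit q j (word m t a)"
      then have "card {j\<in>{..<n}. qudit q j (word m' t' a) \<noteq> qudit q j (word m t a)} \<le> card S"
        using finite_subset[OF S(1)] by (intro card_mono) auto
      moreover have "d \<le> card {j\<in>{..<n}. qudit q j (word m' t' a) \<noteq> qudit q j (word m t a)}"
        using that by (intro word_distance) simp_all
      ultimately show False using S(2) by linarith
    qed
    then show ?thesis using F[rule_format, OF word_less[OF r(3,4,5)] word_less[OF r(1,2,5)]] by (simp only: if_False)
  qed
  have diag: "(\<Sum>a<C. \<Sum>t<H. E $$ (word m t a, word m t a)) = tr" if m: "m < L" for m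
  proof -
    define \<Phi> where "\<Phi> = (\<lambda>(a, t). restrict (\<lambda>j. qudit q j (word m t a)) S')"
    \<comment> \<open>Injectivity is the strength condition, and there are \<open>q^(h + c)\<close>
      elements on both sides because \<open>card S' = h + c\<close>. So each pattern occurs exactly
      once, whatever \<open>m\<close> is.\<close>
    have bij: "bij_betw \<Phi> ({..<C} \<times> {..<H}) (S' \<rightarrow>\<^sub>E {..<q})"
      unfolding bij_betw_def
    proof
      show inj\<Phi>: "inj_on \<Phi> ({..<C} \<times> {..<H})"
      proof (rule inj_onI, clarsimp)
        fix a t a' t' assume r: "a < C" "t < H" "a' < C" "t' < H" and eq: "\<Phi> (a, t) = \<Phi> (a', t')"
        have "\<forall>j\<in>S'. qudit q j (word m t a) = qudit q j (word m t' a')"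
        proof
          fix j assume "j \<in> S'"
          then show "qudit q j (word m t a) = qudit q j (word m t' a')"
            using fun_cong[OF eq, of j] by (simp add: \<Phi>_def)
        qed
        then show "a = a' \<and> t = t'"
          using inj[THEN spec, THEN mp, OF m, THEN spec, THEN mp, OF r(2), THEN spec, THEN mp, OF r(4),
            THEN spec, THEN mp, OF r(1), THEN spec, THEN mp, OF r(3)] by simp
      qed
      show "\<Phi> ` ({..<C} \<times> {..<H}) = S' \<rightarrow>\<^sub>E {..<q}"
      proof (rule card_subset_eq)
        show "finite (S' \<rightarrow>\<^sub>E {..<q})" using finS' by (intro finite_PiE) auto
        show "\<Phi> ` ({..<C} \<times> {..<H}) \<subseteq> S' \<rightarrow>\<^sub>E {..<q}"
          using q_pos by (auto simp: \<Phi>_def PiE_iff qudit_def)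
        show "card (\<Phi> ` ({..<C} \<times> {..<H})) = card (S' \<rightarrow>\<^sub>E {..<q})"
          using finS' S'(3) by (simp add: card_image[OF inj\<Phi>] card_PiE power_add mult.commute)
      qed
    qed
    have "(\<Sum>a<C. \<Sum>t<H. E $$ (word m t a, word m t a)) = (\<Sum>p\<in>{..<C} \<times> {..<H}. D (\<Phi> p))"
      unfolding sum.cartesian_product
    proof (intro sum.cong refl, clarsimp)
      fix a t assume r: "a < C" "t < H"
      have "(\<lambda>j. if j \<in> S then \<Phi> (a, t) j else 0) = (\<lambda>j. if j \<in> S then qudit q j (word m t a) else 0)"
        by (rule ext) (use S'(1) in \<open>auto simp: \<Phi>_def\<close>)
      then show "E $$ (word m t a, word m t a) = D (\<Phi> (a, t))"
        using F[rule_format, OF word_less[OF m r(2,1)] word_less[OF m r(2,1)]]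
        by (simp add: D_def Let_def)
    qed
    also have "\<dots> = tr" unfolding tr_def using bij by (rule sum.reindex_bij_betw)
    finally show ?thesis .
  qed
  have "mat_adjoint B * (tensor_mat E (1\<^sub>m C) * B) = (\<beta> * \<beta> * \<alpha> * \<alpha> * tr) \<cdot>\<^sub>m 1\<^sub>m L"
  proof (rule eq_matI)
    fix m' m assume "m' < dim_row ((\<beta> * \<beta> * \<alpha> * \<alpha> * tr) \<cdot>\<^sub>m 1\<^sub>m L)"
      "m < dim_col ((\<beta> * \<beta> * \<alpha> * \<alpha> * tr) \<cdot>\<^sub>m 1\<^sub>m L)"
    then have m: "m' < L" "m < L" by simp_all
    have "(\<Sum>a<C. \<Sum>t'<H. \<Sum>t<H. E $$ (word m' t' a, word m t a)) = (if m' = m then tr else 0)"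
    proof (cases "m' = m")
      case True
      have "(\<Sum>t<H. E $$ (word m t' a, word m t a)) = E $$ (word m t' a, word m t' a)"
        if "t' < H" "a < C" for t' a
      proof -
        have "(\<Sum>t<H. E $$ (word m t' a, word m t a)) =
            (\<Sum>t<H. if t = t' then E $$ (word m t' a, word m t' a) else 0)"
          using that m offdiag by (intro sum.cong) auto
        then show ?thesis using that by simp
      qed
      then show ?thesis using True diag[OF m(2)] by simp
    next
      case False
      then show ?thesis using m offdiag by (simp add: sum.neutral)
    qed
    then show "(mat_adjoint B * (tensor_mat E (1\<^sub>m C) * B)) $$ (m', m) =
        ((\<beta> * \<beta> * \<alpha> * \<alpha> * tr) \<cdot>\<^sub>m 1\<^sub>m L) $$ (m', m)"
      using m by (simp only: matrix_element[OF E m]) simp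
  qed (simp_all add: B_def mat_adjoint_def)
  then show ?thesis using detects_iff[OF E] by blast
qed

text \<open>Two words of different messages with the same \<open>a\<close> and at most
  \<open>d\<close> differing positions give an error on those positions with a nonzero off-diagonal
  matrix element.\<close>

lemma detects_all_below_bound:
  assumes "detects_all_below q n c P d'"
  shows "d' \<le> d"
proof (rule ccontr)
  assume "\<not> d' \<le> d"
  obtain m t m' t' a where r: "m < L" "t < H" "m' < L" "t' < H" "a < C" and "m \<noteq> m'"
    and d: "card {j\<in>{..<n}. qudit q j (word m t a) \<noteq> qudit q j (word m' t' a)} \<le> d"
    using word_distance_attained by (elim exE conjE) (rule that)
  define S where "S = {j\<in>{..<n}. qudit q j (word m t a) \<noteq> qudit q j (word m' t' a)}"
  define s where "s x = (\<lambda>j. if j \<in> S then qudit q j x else 0)" for x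
  \<comment> \<open>On \<open>S\<close> this is the matrix unit taking the pattern of
    \<open>word m' t' a\<close> to that of \<open>word m t a\<close>; elsewhere it is the
    identity.\<close>
  define E :: "complex mat" where "E = mat N N (\<lambda>(x, y).
    if (\<forall>j\<in>{..<n} - S. qudit q j x = qudit q j y) \<and> s x = s (word m t a) \<and> s y = s (word m' t' a)
    then 1 else 0)"
  have E: "E \<in> carrier_mat N N" by (simp add: E_def)
  have "acts_within q n S E"
    unfolding acts_within_def
  proof (intro conjI exI allI impI)
    fix x y assume "x < q ^ n" "y < q ^ n"
    then show "E $$ (x, y) = (if \<forall>j\<in>{..<n} - S. qudit q j x = qudit q j y
      then (\<lambda>u v. if u = s (word m t a) \<and> v = s (word m' t' a) then 1 else 0)
        (\<lambda>j. if j \<in> S then qudit q j x else 0) (\<lambda>j. if j \<in> S then qudit q j y else 0)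
      else 0)" by (simp add: E_def flip: s_def)
  qed (rule E)
  moreover have "S \<subseteq> {..<n}" "card S < d'" using d \<open>\<not> d' \<le> d\<close> by (auto simp: S_def)
  ultimately have "detects q c P E" using assms unfolding detects_all_below_def by blast
  then obtain z where "mat_adjoint B * (tensor_mat E (1\<^sub>m C) * B) = z \<cdot>\<^sub>m 1\<^sub>m L"
    using detects_iff[OF E] by blast
  then have "(mat_adjoint B * (tensor_mat E (1\<^sub>m C) * B)) $$ (m, m') = 0"
    using r \<open>m \<noteq> m'\<close> by simp
  moreover have "\<beta> * \<beta> * \<alpha> * \<alpha> \<noteq> 0"
    using \<alpha>_square \<beta>_square by auto
  ultimately have zero: "(\<Sum>b<C. \<Sum>u<H. \<Sum>v<H. E $$ (word m u b, word m' v b)) = 0"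
    by (simp add: matrix_element[OF E r(1,3)])
  \<comment> \<open>All entries of \<open>E\<close> are 0 or 1, so no cancellation can occur in the
    sum, and the chosen pair of words contributes 1.\<close>
  define e where "e = (\<lambda>(b, u, v). Re (E $$ (word m u b, word m' v b)))"
  have e_nonneg: "e p \<ge> 0" if "p \<in> {..<C} \<times> {..<H} \<times> {..<H}" for p
    using that r word_less by (auto simp: e_def E_def)
  have "(\<Sum>b<C. \<Sum>u<H. \<Sum>v<H. Re (E $$ (word m u b, word m' v b))) = 0"
    using arg_cong[OF zero, of Re] by simp
  then have "sum e ({..<C} \<times> {..<H} \<times> {..<H}) = 0"
    unfolding sum.cartesian_product e_def by simp
  then have "e (a, t, t') = 0"
    using e_nonneg r by (subst (asm) sum_nonneg_eq_0_iff) auto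
  moreover have "e (a, t, t') = 1"
    using r word_less by (auto simp: e_def E_def S_def)
  ultimately show False by simp
qed

theorem is_EAQECC: "EAQECC q n K d c (code_space q K c V)"
proof -
  have "min_distance q n c P d"
    unfolding min_distance_def
  proof (intro conjI allI impI)
    show "detects_all_below q n c P d"
      unfolding detects_all_below_def by (intro allI impI, elim conjE) (rule detects_if_small_support)
  qed (rule detects_all_below_bound)
  then show ?thesis
    unfolding EAQECC_def using encoding_isometry projector by blast
qed

end

section \<open>The almost MDS codes\<close>

context twisted_codes
begin

lemma word_code:
  "word_code q (q + 2) K h (r + 2) (q - k + 2) (\<lambda>m t a. undigits q (q + 2) (symbol m t a))"
proof -
  have qudit: "qudit q j (undigits q (q + 2) (symbol m t a)) = symbol m t a j"
    if "j < q + 2" for m t a j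
    using symbol_less that by (rule qudit_undigits)
  have disagree: "{j\<in>{..<q + 2}. qudit q j (undigits q (q + 2) (symbol m t a)) \<noteq>
      qudit q j (undigits q (q + 2) (symbol m' t' a))} =
    {j\<in>{..<q + 2}. symbol m t a j \<noteq> symbol m' t' a j}" for m t a m' t'
    by (intro Collect_cong conj_cong refl) (simp only: qudit lessThan_iff)
  show ?thesis
  proof (unfold_locales, goal_cases)
    case 1
    show ?case by (rule q_pos)
  next
    case (2 m t a)
    show ?case by (intro undigits_less symbol_less)
  next
    case (3 m t a m' t' a')
    have "symbol m t a j = symbol m' t' a' j" if "j < q + 2" for j
      using arg_cong[OF 3(7), of "qudit q j"] by (simp only: qudit[OF that])
    then show ?case using 3 by (intro injective)
  next
    case (4 m t m' t' a)
    then show ?case unfolding disagree by (intro distance)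
  next
    case (5 S)
    show ?case
    proof (rule strength[OF 5])
      fix S'
      assume S': "S \<subseteq> S'" "S' \<subseteq> {..<q + 2}" "card S' = h + (r + 2)"
        and sep: "\<And>m t a t' a'. m < q ^ K \<Longrightarrow> t < q ^ h \<Longrightarrow> t' < q ^ h \<Longrightarrow>
          a < q ^ (r + 2) \<Longrightarrow> a' < q ^ (r + 2) \<Longrightarrow>
          (\<And>j. j \<in> S' \<Longrightarrow> symbol m t a j = symbol m t' a' j) \<Longrightarrow> t = t' \<and> a = a'"
      show ?case
      proof (rule exI[of _ S'], intro conjI S' allI impI)
        fix m t t' a a'
        assume r: "m < q ^ K" "t < q ^ h" "t' < q ^ h" "a < q ^ (r + 2)" "a' < q ^ (r + 2)"
          and eq: "\<forall>j\<in>S'. qudit q j (undigits q (q + 2) (symbol m t a)) =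
            qudit q j (undigits q (q + 2) (symbol m t' a'))"
        have "symbol m t a j = symbol m t' a' j" if "j \<in> S'" for j
          using eq that S'(2) qudit by (metis lessThan_iff subsetD)
        from sep[OF r this] show "t = t'" "a = a'" by simp_all
      qed
    qed
  next
    case 6
    obtain m t m' t' where "m < q ^ K" "t < q ^ h" "m' < q ^ K" "t' < q ^ h" "m \<noteq> m'"
      "card {j\<in>{..<q + 2}. symbol m t 0 j \<noteq> symbol m' t' 0 j} \<le> q - k + 2"
      by (rule distance_attained)
    moreover have "0 < q ^ (r + 2)" using q_pos by simp
    ultimately show ?case unfolding disagree by blast
  qed
qed

end

text \<open>The choice \<open>r = q - k - h\<close> turns \<open>r + 2\<close> into the required
  number of ebits, and the two inequalities give \<open>r \<ge> 2\<close>.\<close>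

lemma AMDS_EAQECC_exists:
  fixes p e q k h :: nat
  assumes p: "prime p" and q: "q = p ^ e" and hk: "h < k" and kq: "2 * k < q"
  shows "\<exists>W. AMDS_EAQECC q (q + 2) (k - h) (q - k + 2) (q + 2 - k - h) W"
proof -
  have "q > 1" using hk kq by linarith
  then obtain M :: "int poly set" and sym rep where "finite_residue_field M q sym rep"
    using finite_residue_field_exists[OF p q] by blast
  then interpret finite_residue_field M q sym rep .
  define r where "r = q - k - h"
  have r: "r \<ge> 2" using hk kq by (simp add: r_def)
  \<comment> \<open>As \<open>k > 0\<close>, \<open>2 * k < q\<close> gives \<open>q > 2\<close>, so
    some residue is neither 0 nor 1. It becomes the leading coefficient of \<open>w\<close>.\<close>
  have "card {sym 0, sym 1} < card {..<q}" using hk kq by (simp add: card_insert_if)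
  then have "\<not> {..<q} \<subseteq> {sym 0, sym 1}" using card_mono[of "{sym 0, sym 1}" "{..<q}"] by auto
  then obtain i where i: "i < q" "i \<noteq> sym 0" "i \<noteq> sym 1" by auto
  have u: "rep i - 0 \<notin> M" "rep i - 1 \<notin> M"
    using i unfolding sym_eq_iff[symmetric] by (simp_all add: sym_rep)
  obtain w where w: "degree w \<le> r" "coeff w r = rep i" "\<And>j. j < q \<Longrightarrow> poly w (rep j) \<notin> M"
    using exists_poly_without_roots[OF r] by blast
  interpret twisted_codes M q sym rep k h "k - h" r "rep i" w
    by unfold_locales (use hk kq r u w in \<open>auto simp: r_def\<close>)
  interpret word_code q "q + 2" "k - h" h "r + 2" "q - k + 2"
    "\<lambda>m t a. undigits q (q + 2) (symbol m t a)"
    by (rule word_code)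
  have "q + 2 - k - h = r + 2" using hk kq by (simp add: r_def)
  moreover have "int (q + 2) + int (r + 2) - int (k - h) = 2 * int (q - k + 2)"
    using hk kq by (simp add: r_def of_nat_diff)
  ultimately show ?thesis
    using is_EAQECC unfolding AMDS_EAQECC_def by metis
qed

text \<open>All four statements reduce to \<open>h < k\<close> and \<open>2 * k < q\<close>. The
  latter comes from \<open>3 * m < q\<close> together with lower bounds on \<open>q\<close>.\<close>

theorem mainTheorem19:
  fixes p e l q :: nat
  assumes "prime p" and "q = p ^ e" and "q > 4" and "l > 0" and "2 * l dvd e"
  shows
    "(\<forall>k h. 3 \<le> k \<and> k \<le> (q - 1) div (p ^ l + 1) \<and> h \<le> k - 2 \<longrightarrow>
        (\<exists>W. AMDS_EAQECC q (q + 2) (k - h) (q - k + 2) (q + 2 - k - h) W)) \<and>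
     (\<forall>k h. k = 1 + (q - 1) div (p ^ l + 1) \<and> h \<le> k - 2 \<longrightarrow>
        (\<exists>W. AMDS_EAQECC q (q + 2) (k - h) (q - k + 2) (q + 2 - k - h) W)) \<and>
     (\<forall>k. k = 1 + (q - 1) div (p ^ l + 1) \<longrightarrow>
        (\<exists>W. AMDS_EAQECC q (q + 2) 1 (q - k + 2) (q + 3 - 2 * k) W)) \<and>
     (\<forall>k. (q - 1) div (p ^ l + 1) \<ge> p ^ l \<and> k = 2 + (q - 1) div (p ^ l + 1) \<longrightarrow>
        (\<exists>W. AMDS_EAQECC q (q + 2) 1 (q - k + 2) (q + 3 - 2 * k) W))"
proof -
  define m where "m = (q - 1) div (p ^ l + 1)"
  have p2: "p \<ge> 2" using assms(1) by (rule prime_ge_2_nat)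
  have "p ^ 1 \<le> p ^ l" using p2 assms(4) by (intro power_increasing) auto
  then have pl: "p ^ l + 1 \<ge> 3" using p2 by simp
  have m: "m * (p ^ l + 1) = q - 1"
    unfolding m_def assms(2) by (rule dvd_div_mult_self) (rule succ_power_dvd[OF assms(5)])
  have "3 * m \<le> q - 1" using mult_le_mono2[OF pl, of m] unfolding m by (simp add: mult.commute)
  then have m3: "3 * m < q" using assms(3) by arith
  have "e > 0" using assms(2,3) by (cases "e = 0") auto
  then have e: "e > 1" using dvd_imp_le[OF assms(5)] assms(4) by linarith
  \<comment> \<open>Since \<open>e \<ge> 2\<close> and \<open>q > 4\<close>, \<open>q\<close> is at
    least 8 if \<open>p = 2\<close> and at least 9 otherwise. With \<open>3 * m < q\<close> this
    gives \<open>2 * (1 + m) < q\<close>.\<close>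
  have q7: "q \<ge> 7"
  proof (cases "p = 2")
    case True
    have "e \<noteq> 2" using True assms(2,3) by auto
    then have "(2::nat) ^ 3 \<le> 2 ^ e" using e by (intro power_increasing) auto
    then show ?thesis using True assms(2) by simp
  next
    case False
    then have "(3::nat) ^ 2 \<le> p ^ 2" using p2 by (intro power_mono) auto
    also have "\<dots> \<le> p ^ e" using p2 e by (intro power_increasing) auto
    finally show ?thesis using assms(2) by simp
  qed
  have *: "\<exists>W. AMDS_EAQECC q (q + 2) (k - h) (q - k + 2) (q + 2 - k - h) W"
    if "h < k" "2 * k < q" for k h
    using AMDS_EAQECC_exists[OF assms(1,2)] that by blast
  \<comment> \<open>The case \<open>h = k - 1\<close>, which leaves one logical qudit.\<close>
  have **: "\<exists>W. AMDS_EAQECC q (q + 2) 1 (q - k + 2) (q + 3 - 2 * k) W"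
    if "0 < k" "2 * k < q" for k
  proof -
    have "k - (k - 1) = 1" "q + 2 - k - (k - 1) = q + 3 - 2 * k" using that by auto
    then show ?thesis using *[of "k - 1" k] that by simp
  qed
  \<comment> \<open>If \<open>e = 2 * l\<close>, then \<open>m = p^l - 1\<close>, contrary to the
    assumption. So \<open>e \<ge> 4\<close> and \<open>q \<ge> 16\<close>.\<close>
  have part4: "2 * (2 + m) < q" if "p ^ l \<le> m"
  proof -
    obtain s where s: "e = 2 * l * s" using assms(5) by (elim dvdE)
    have "s \<noteq> 1"
    proof
      assume "s = 1"
      then have "q = p ^ l * p ^ l" using assms(2) s by (simp add: mult_2 power_add)
      moreover have "p ^ l * (p ^ l + 1) \<le> q - 1" using mult_le_mono1[OF that, of "p ^ l + 1"] m by simp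
      ultimately show False using assms(3) by simp
    qed
    then have "s \<ge> 2" using e s by (cases s) auto
    then have "2 * 1 * 2 \<le> e" unfolding s using assms(4) by (intro mult_le_mono) auto
    then have "(2::nat) ^ 4 \<le> 2 ^ e" by (intro power_increasing) auto
    also have "\<dots> \<le> q" unfolding assms(2) using p2 by (intro power_mono) auto
    finally have "q \<ge> 16" by simp
    then show ?thesis using m3 by presburger
  qed
  show ?thesis
    unfolding m_def[symmetric]
  proof (intro conjI allI impI)
    fix k h assume "3 \<le> k \<and> k \<le> m \<and> h \<le> k - 2"
    then show "\<exists>W. AMDS_EAQECC q (q + 2) (k - h) (q - k + 2) (q + 2 - k - h) W"
      using m3 by (intro *) linarith+
  next
    fix k h assume k: "k = 1 + m \<and> h \<le> k - 2"
    then have "h < k" "2 * k < q" using m3 q7 by linarith+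
    then show "\<exists>W. AMDS_EAQECC q (q + 2) (k - h) (q - k + 2) (q + 2 - k - h) W" by (rule *)
  next
    fix k assume k: "k = 1 + m"
    then have "0 < k" "2 * k < q" using m3 q7 by linarith+
    then show "\<exists>W. AMDS_EAQECC q (q + 2) 1 (q - k + 2) (q + 3 - 2 * k) W" by (rule **)
  next
    fix k assume "p ^ l \<le> m \<and> k = 2 + m"
    then have "0 < k" "2 * k < q" using part4 by auto
    then show "\<exists>W. AMDS_EAQECC q (q + 2) 1 (q - k + 2) (q + 3 - 2 * k) W" by (rule **)
  qed
qed

end
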